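(* Let $c \in \mathbb{R}$, $A > 0$ and $\beta \in (0,1]$. Assume that the deep-water Babenko equation $$(c^2 K_\infty - 1)\eta - \eta K_\infty \eta - \frac{1}{2} K_\infty(\eta^2) = 0$$ admits a real-valued, $2\pi$-periodic solution $\eta \in \mathrm{Dom}(K_\infty) \subset L^2(\mathbb{T})$ with the local behavior $$\eta(u) = \frac{c^2}{2} - A|u|^{\beta} + o(|u|^{\beta}) \quad \text{as } u \to 0.$$ Then $\beta = \frac{2}{3}$.
   Context: $\mathbb{T}$ denotes the $2\pi$-periodic domain $\mathbb{R}/2\pi\mathbb{Z}$, with coordinate $u$ (represented by $u \in [-\pi,\pi]$). The operator $K_\infty$ is the linear self-adjoint operator in $L^2(\mathbb{T})$ given by the Fourier multiplier $\widehat{(K_\infty)}_n = |n|$, $n \in \mathbb{Z}$, with domain $\mathrm{Dom}(K_\infty) = \{ f \in L^2(\mathbb{T}) : \sum_{n} n^2 |\hat f_n|^2 < \infty\}$. Equivalently, $K_\infty = -\mathcal{H}\partial_u$, where $\mathcal{H}$ is the periodic Hilbert transform with Fourier symbol $i\,\mathrm{sgn}(n)$ for $n \neq 0$ and $0$ for $n = 0$. It is the limit as $h \to \infty$ of the operators $K_h$ with symbol $n\coth(hn)$ for $n \ne 0$ and $0$ for $n = 0$. Pointwise behavior of $\eta$ refers to its continuous representative. *)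

theory Defs
  imports "HOL-Analysis.Analysis" "HOL-Library.Landau_Symbols"
begin

text \<open>
  Elements of \<open>L\<^sup>2\<close> of the circle of length \<open>2\<pi>\<close> are represented by everywhere-defined
  \<open>2\<pi>\<close>-periodic functions on the line. There is no quotient by null sets: equality in
  \<open>L\<^sup>2\<close> is equality almost everywhere on \<open>[-\<pi>, \<pi>]\<close>.
\<close>

abbreviation circle_measure :: "real measure" where
  "circle_measure \<equiv> lebesgue_on {-pi..pi}"

definition L2_circle :: "(real \<Rightarrow> complex) set" where
  "L2_circle = {f. (\<forall>u. f (u + 2 * pi) = f u) \<and>
                   f \<in> borel_measurable circle_measure \<and>
                   integrable circle_measure (\<lambda>u. (cmod (f u))\<^sup>2)}"

definition fourier_coeff :: "(real \<Rightarrow> complex) \<Rightarrow> int \<Rightarrow> complex" where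
  "fourier_coeff f n =
     (LINT u|circle_measure. f u * exp (- \<i> * of_int n * of_real u)) / (2 * of_real pi)"

definition Dom_K_inf :: "(real \<Rightarrow> complex) set" where
  "Dom_K_inf = {f \<in> L2_circle.
     (\<lambda>n::int. (of_int n)\<^sup>2 * (cmod (fourier_coeff f n))\<^sup>2) summable_on UNIV}"

text \<open>
  The Fourier multiplier with symbol \<open>\<bar>n\<bar>\<close>. For \<open>f \<in> Dom_K_inf\<close> a function \<open>g\<close> as below
  exists (Riesz-Fischer) and is unique up to a null set (uniqueness of Fourier coefficients),
  so the choice only selects a representative of the class. For other \<open>f\<close> the value is
  unspecified.
\<close>

definition K_inf :: "(real \<Rightarrow> complex) \<Rightarrow> real \<Rightarrow> complex" where
  "K_inf f = (SOME g. g \<in> L2_circle \<and>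
                (\<forall>n. fourier_coeff g n = of_int \<bar>n\<bar> * fourier_coeff f n))"

end

theory Submission
  imports Defs
begin

text \<open>
  Write \<open>K\<close> for the multiplier with symbol \<open>\<bar>n\<bar>\<close> and \<open>v = c\<^sup>2 / 2 - \<eta>\<close>, so that
  \<open>v(u) = A \<bar>u\<bar>\<^sup>\<beta> + o(\<bar>u\<bar>\<^sup>\<beta>)\<close> at the crest. The function \<open>f = 1 + K \<eta> - \<i> \<eta>'\<close> has only modes
  \<open>n \<ge> 0\<close>, with mean value \<open>1\<close>: it is the boundary value of a function analytic in the disc.
  In terms of Fourier coefficients the Babenko equation says that \<open>g = v \<cdot> cnj f\<close> also has only modes
  \<open>n \<ge> 0\<close>, with mean value \<open>c\<^sup>2 / 2\<close>. Hence \<open>f g = v \<bar>f\<bar>\<^sup>2\<close> is real and has only modes \<open>n \<ge> 0\<close>.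
  Such a function is constant, which gives the Bernoulli law \<open>v \<bar>f\<bar>\<^sup>2 = c\<^sup>2 / 2\<close> almost everywhere
  (\<open>Babenko_imp_Bernoulli\<close>). The two bounds on \<open>\<beta>\<close> compare the size of \<open>f\<close> that this law
  predicts with the size of \<open>\<eta>\<close>.

  Lower bound (\<open>exponent_lower_bound\<close>). On \<open>[x, 2x]\<close> the law gives
  \<open>\<bar>\<eta>'\<bar> \<le> \<bar>f\<bar> \<le> const \<cdot> x powr (-\<beta>/2)\<close>, hence \<open>\<bar>\<eta>(2x) - \<eta>(x)\<bar> \<le> const \<cdot> x powr (1 - \<beta>/2)\<close>,
  while the asymptotics make this difference comparable to \<open>x powr \<beta>\<close>. So \<open>\<beta> \<ge> 1 - \<beta>/2\<close>.
  Since the constant in the upper bound is a multiple of \<open>\<bar>c\<bar>\<close>, the same comparison shows \<open>c \<noteq> 0\<close>.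

  Upper bound (\<open>exponent_upper_bound\<close>). Extend \<open>f\<close> and \<open>g\<close> to the disc. Since all positive Fourier
  coefficients of \<open>f g\<close> vanish, \<open>f(r) g(r) = c\<^sup>2 / 2\<close> for every \<open>r < 1\<close>. By the law,
  \<open>\<bar>g\<bar>\<close> is at most a constant times \<open>\<bar>u\<bar> powr (\<beta>/2)\<close> on the circle, and the Poisson kernel turns
  this into \<open>\<bar>g(r)\<bar> \<le> const \<cdot> (1 - r) powr (\<beta>/2 - e)\<close> for any small \<open>e > 0\<close>. On the other hand
  \<open>f(r) - 1\<close> is an integral of \<open>v\<close> against the derivative of the Cauchy kernel, so that
  \<open>\<bar>v\<bar> \<le> const \<cdot> \<bar>u\<bar> powr \<beta>\<close> implies \<open>\<bar>f(r)\<bar> \<le> 1 + const \<cdot> (1 - r) powr (\<beta> - 1 - e)\<close>. If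
  \<open>\<beta> > 2/3\<close>, both \<open>\<beta>/2\<close> and \<open>\<beta>/2 + (\<beta> - 1)\<close> are positive, and the product would tend to \<open>0\<close>.

  The analytic foundation is \<open>L\<^sup>2\<close> theory of Fourier series: uniqueness of coefficients for
  integrable functions (\<open>fourier_coeff_unique\<close>), the Riesz-Fischer theorem (\<open>Riesz_Fischer\<close>), which
  also shows that the values of \<open>K_inf\<close> in the equation are the intended ones (\<open>K_inf_spec\<close>), and
  convolution of coefficients under products (\<open>fourier_coeff_mult\<close>).
\<close>

section \<open>Square-integrable functions on the circle\<close>

definition mode :: "int \<Rightarrow> real \<Rightarrow> complex" where
  "mode n u = cis (of_int n * u)"

text \<open>
  Membership in \<open>L2_circle\<close> without periodicity: Fourier coefficients only see one period, and
  products with indicator functions of subintervals occur below.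
\<close>

definition square_integrable :: "(real \<Rightarrow> complex) \<Rightarrow> bool" where
  "square_integrable f \<longleftrightarrow> f \<in> borel_measurable circle_measure \<and>
     integrable circle_measure (\<lambda>u. (cmod (f u))\<^sup>2)"

lemma finite_measure_circle: "finite_measure circle_measure"
  by (rule finite_measureI) (simp add: emeasure_restrict_space)

lemma measure_circle: "measure circle_measure (space circle_measure) = 2 * pi"
  by (simp add: measure_restrict_space)

lemma cmod_mode [simp]: "cmod (mode n u) = 1"
  by (simp add: mode_def)

lemma mode_0 [simp]: "mode 0 u = 1"
  by (simp add: mode_def)

lemma mode_add: "mode (m + n) u = mode m u * mode n u"
  by (simp add: mode_def cis_mult algebra_simps)

lemma cnj_mode: "cnj (mode n u) = mode (- n) u"
  by (simp add: mode_def cis_cnj)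

lemma mode_mult_mode: "mode m u * mode n u = mode (m + n) u"
  by (simp add: mode_add)

lemma mode_periodic: "mode n (u + 2 * pi) = mode n u"
proof -
  have "cis (2 * pi * of_int n) = 1" by (rule cis_multiple_2pi) simp
  then show ?thesis
    by (simp add: mode_def distrib_left cis_mult[symmetric] mult.commute mult.left_commute)
qed

lemma continuous_on_mode [continuous_intros]: "continuous_on S (mode n)"
  unfolding mode_def by (intro continuous_intros)

lemma continuous_imp_measurable_circle:
  fixes f :: "real \<Rightarrow> 'a::euclidean_space"
  shows "continuous_on {-pi..pi} f \<Longrightarrow> f \<in> borel_measurable circle_measure"
  by (rule continuous_imp_measurable_on_sets_lebesgue) auto

lemma measurable_mode [measurable]: "mode n \<in> borel_measurable circle_measure"
  by (intro continuous_imp_measurable_circle continuous_on_mode)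

lemma continuous_bounded_circle:
  fixes g :: "real \<Rightarrow> 'a :: real_normed_vector"
  assumes "continuous_on {-pi..pi} g"
  shows "\<exists>B\<ge>0. \<forall>u\<in>{-pi..pi}. norm (g u) \<le> B"
proof -
  have "compact (g ` {-pi..pi})" by (intro compact_continuous_image assms) auto
  then have "bounded (g ` {-pi..pi})" by (rule compact_imp_bounded)
  then obtain B where "0 < B" "\<forall>x\<in>g ` {-pi..pi}. norm x \<le> B"
    unfolding bounded_pos by blast
  then show ?thesis by (intro exI[of _ B]) simp
qed

lemma AE_circle_neq: "AE u in circle_measure. u \<noteq> a \<and> u \<in> {-pi..pi}"
proof -
  have "{a} \<in> null_sets lebesgue"
    by (intro null_sets_completionI finite_imp_null_set_lborel) simp
  from AE_not_in[OF this] show ?thesis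
    by (simp add: AE_restrict_space_iff) (auto elim: eventually_mono)
qed

lemma integrable_bounded_circle:
  fixes f :: "real \<Rightarrow> complex"
  assumes "f \<in> borel_measurable circle_measure" "\<And>u. cmod (f u) \<le> B"
  shows "integrable circle_measure f"
  by (rule finite_measure.integrable_const_bound[OF finite_measure_circle, of _ B]) (use assms in auto)

lemma integrable_mult_bounded:
  fixes f g :: "real \<Rightarrow> complex"
  assumes "integrable circle_measure f" "g \<in> borel_measurable circle_measure"
    "\<And>u. u \<in> {-pi..pi} \<Longrightarrow> cmod (g u) \<le> B"
  shows "integrable circle_measure (\<lambda>u. f u * g u)"
proof (rule Bochner_Integration.integrable_bound)
  show "integrable circle_measure (\<lambda>u. B * norm (f u))"
    using assms by auto
  show "(\<lambda>u. f u * g u) \<in> borel_measurable circle_measure"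
    using assms by auto
  show "AE u in circle_measure. norm (f u * g u) \<le> norm (B * norm (f u))"
  proof (rule AE_I2)
    fix u assume "u \<in> space circle_measure"
    then have B: "cmod (g u) \<le> B" using assms(3) by (auto simp: space_restrict_space)
    then have "0 \<le> B" using norm_ge_zero order_trans by blast
    then show "norm (f u * g u) \<le> norm (B * norm (f u))"
      using mult_right_mono[OF B norm_ge_zero[of "f u"]]
      by (simp add: norm_mult abs_mult mult.commute)
  qed
qed

lemma integrable_mult_mode:
  "integrable circle_measure f \<Longrightarrow> integrable circle_measure (\<lambda>u. f u * mode n u)"
  by (rule integrable_mult_bounded[where B=1]) auto

lemma fourier_coeff_eq: "fourier_coeff f n = (LINT u|circle_measure. f u * mode (- n) u) / (2 * of_real pi)"
  by (simp add: fourier_coeff_def mode_def cis_conv_exp mult_ac)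

lemma integral_mode: "(LINT u|circle_measure. mode n u) = (if n = 0 then 2 * of_real pi else 0)"
proof (cases "n = 0")
  case True
  then show ?thesis using measure_circle by (simp add: scaleR_conv_of_real)
next
  case False
  have int: "integrable circle_measure (mode n)"
    by (rule integrable_bounded_circle[where B=1]) auto
  have "(mode n has_integral mode n pi / (\<i> * of_int n) - mode n (-pi) / (\<i> * of_int n)) {-pi..pi}"
  proof (rule fundamental_theorem_of_calculus)
    fix x :: real
    have "((\<lambda>u. exp (\<i> * of_int n * of_real u) / (\<i> * of_int n)) has_vector_derivative exp (\<i> * of_int n * of_real x)) (at x within {-pi..pi})"
      using False by (auto intro!: derivative_eq_intros has_vector_derivative_real_field simp: field_simps)
    then show "((\<lambda>u. mode n u / (\<i> * of_int n)) has_vector_derivative mode n x) (at x within {-pi..pi})"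
      by (simp add: mode_def cis_conv_exp mult_ac)
  qed simp
  moreover have "mode n pi = mode n (-pi)"
    using mode_periodic[of n "-pi"] by simp
  ultimately have "integral {-pi..pi} (mode n) = 0" by (simp add: integral_unique)
  then show ?thesis using False lebesgue_integral_eq_integral[OF int] by simp
qed

lemma square_integrable_measurable [measurable_dest]:
  "square_integrable f \<Longrightarrow> f \<in> borel_measurable circle_measure"
  by (simp add: square_integrable_def)

lemma square_integrable_norm_sq:
  "square_integrable f \<Longrightarrow> integrable circle_measure (\<lambda>u. (cmod (f u))\<^sup>2)"
  by (simp add: square_integrable_def)

lemma square_integrable_norm_mult:
  assumes f: "square_integrable f" and g: "square_integrable g"
  shows "integrable circle_measure (\<lambda>u. cmod (f u) * cmod (g u))"
proof (rule Bochner_Integration.integrable_bound)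
  show "integrable circle_measure (\<lambda>u. (cmod (f u))\<^sup>2 + (cmod (g u))\<^sup>2)"
    using assms by (simp add: square_integrable_def)
  show "(\<lambda>u. cmod (f u) * cmod (g u)) \<in> borel_measurable circle_measure"
    using assms by (auto simp: square_integrable_def)
  have "x * y \<le> x\<^sup>2 + y\<^sup>2" if "x \<ge> 0" "y \<ge> 0" for x y :: real
    using sum_squares_bound[of x y] mult_nonneg_nonneg[OF that] by linarith
  then show "AE u in circle_measure. norm (cmod (f u) * cmod (g u)) \<le> norm ((cmod (f u))\<^sup>2 + (cmod (g u))\<^sup>2)"
    by (auto simp: abs_mult)
qed

lemma square_integrable_mult:
  assumes "square_integrable f" "square_integrable g"
  shows "integrable circle_measure (\<lambda>u. f u * g u)"
proof (rule Bochner_Integration.integrable_bound[OF square_integrable_norm_mult[OF assms]])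
  show "(\<lambda>u. f u * g u) \<in> borel_measurable circle_measure"
    using assms by (auto simp: square_integrable_def)
qed (auto simp: norm_mult)

lemma square_integrable_add:
  assumes "square_integrable f" "square_integrable g"
  shows "square_integrable (\<lambda>u. f u + g u)"
  unfolding square_integrable_def
proof
  show m: "(\<lambda>u. f u + g u) \<in> borel_measurable circle_measure"
    using assms by (auto simp: square_integrable_def)
  show "integrable circle_measure (\<lambda>u. (cmod (f u + g u))\<^sup>2)"
  proof (rule Bochner_Integration.integrable_bound)
    show "integrable circle_measure (\<lambda>u. 2 * (cmod (f u))\<^sup>2 + 2 * (cmod (g u))\<^sup>2)"
      using assms by (simp add: square_integrable_def)
    have "(cmod (f u + g u))\<^sup>2 \<le> 2 * (cmod (f u))\<^sup>2 + 2 * (cmod (g u))\<^sup>2" for u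
    proof -
      have "(cmod (f u + g u))\<^sup>2 \<le> (cmod (f u) + cmod (g u))\<^sup>2"
        by (intro power_mono norm_triangle_ineq) auto
      then show ?thesis
        using sum_squares_bound[of "cmod (f u)" "cmod (g u)"] by (simp add: power2_sum)
    qed
    then show "AE u in circle_measure. norm ((cmod (f u + g u))\<^sup>2) \<le> norm (2 * (cmod (f u))\<^sup>2 + 2 * (cmod (g u))\<^sup>2)"
      by simp
  qed (use m in auto)
qed

lemma square_integrable_cnj: "square_integrable f \<Longrightarrow> square_integrable (\<lambda>u. cnj (f u))"
  by (auto simp: square_integrable_def intro: borel_measurable_continuous_on[of cnj] continuous_intros)

lemma square_integrable_bounded_mult:
  assumes f: "square_integrable f" and g: "g \<in> borel_measurable circle_measure"
    and B: "\<And>u. u \<in> {-pi..pi} \<Longrightarrow> cmod (g u) \<le> B"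
  shows "square_integrable (\<lambda>u. g u * f u)"
  unfolding square_integrable_def
proof
  show m: "(\<lambda>u. g u * f u) \<in> borel_measurable circle_measure"
    using assms by (auto simp: square_integrable_def)
  have "integrable circle_measure (\<lambda>u. of_real ((cmod (f u))\<^sup>2) * (of_real ((cmod (g u))\<^sup>2) :: complex))"
  proof (rule integrable_mult_bounded)
    show "integrable circle_measure (\<lambda>u. of_real ((cmod (f u))\<^sup>2) :: complex)"
      using f unfolding square_integrable_def by (intro integrable_of_real) auto
    show "(\<lambda>u. of_real ((cmod (g u))\<^sup>2) :: complex) \<in> borel_measurable circle_measure"
      using g by auto
    show "cmod (of_real ((cmod (g u))\<^sup>2)) \<le> B\<^sup>2" if "u \<in> {-pi..pi}" for u
      using power_mono[OF B[OF that], of 2] by (simp add: norm_power)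
  qed
  then have "integrable circle_measure (\<lambda>u. Re (of_real ((cmod (f u))\<^sup>2) * of_real ((cmod (g u))\<^sup>2)))"
    by (rule integrable_Re)
  then show "integrable circle_measure (\<lambda>u. (cmod (g u * f u))\<^sup>2)"
    by (simp add: norm_mult power_mult_distrib mult.commute)
qed

lemma square_integrable_bounded:
  assumes "f \<in> borel_measurable circle_measure" "\<And>u. u \<in> {-pi..pi} \<Longrightarrow> cmod (f u) \<le> B"
  shows "square_integrable f"
proof -
  have "square_integrable (\<lambda>_. 1)"
    unfolding square_integrable_def
    using finite_measure.integrable_const[OF finite_measure_circle, of "1::real"] by simp
  from square_integrable_bounded_mult[OF this assms] show ?thesis by simp
qed

lemma square_integrable_mode: "square_integrable (mode n)"
  by (rule square_integrable_bounded[where B=1]) auto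

lemma square_integrable_const: "square_integrable (\<lambda>_. c)"
  by (rule square_integrable_bounded[where B="cmod c"]) auto

lemma square_integrable_cmult: "square_integrable f \<Longrightarrow> square_integrable (\<lambda>u. c * f u)"
  by (rule square_integrable_bounded_mult[where B="cmod c"]) auto

lemma square_integrable_diff:
  assumes "square_integrable f" "square_integrable g"
  shows "square_integrable (\<lambda>u. f u - g u)"
  using square_integrable_add[OF assms(1) square_integrable_cmult[OF assms(2), of "-1"]] by simp

lemma square_integrable_sum:
  assumes "\<And>i. i \<in> I \<Longrightarrow> square_integrable (f i)"
  shows "square_integrable (\<lambda>u. \<Sum>i\<in>I. f i u)"
  using assms
proof (induction I rule: infinite_finite_induct)
  case (insert i I)
  then show ?case by (auto intro: square_integrable_add)
qed (use square_integrable_const[of 0] in auto)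

lemma square_integrable_integrable: "square_integrable f \<Longrightarrow> integrable circle_measure f"
  using square_integrable_mult[OF _ square_integrable_const[of 1]] by simp

lemma fourier_coeff_add:
  "integrable circle_measure f \<Longrightarrow> integrable circle_measure g \<Longrightarrow>
   fourier_coeff (\<lambda>u. f u + g u) n = fourier_coeff f n + fourier_coeff g n"
  by (simp add: fourier_coeff_eq distrib_right integrable_mult_mode add_divide_distrib)

lemma fourier_coeff_cmult: "fourier_coeff (\<lambda>u. c * f u) n = c * fourier_coeff f n"
  by (simp add: fourier_coeff_eq mult.assoc)

lemma fourier_coeff_diff:
  "integrable circle_measure f \<Longrightarrow> integrable circle_measure g \<Longrightarrow>
   fourier_coeff (\<lambda>u. f u - g u) n = fourier_coeff f n - fourier_coeff g n"
  by (simp add: fourier_coeff_eq left_diff_distrib integrable_mult_mode diff_divide_distrib)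

lemma fourier_coeff_mode: "fourier_coeff (mode m) n = (if m = n then 1 else 0)"
  by (simp add: fourier_coeff_eq mode_mult_mode integral_mode)

lemma fourier_coeff_const: "fourier_coeff (\<lambda>_. c) n = (if n = 0 then c else 0)"
  using fourier_coeff_cmult[of c "mode 0" n] fourier_coeff_mode[of 0 n] by auto

lemma fourier_coeff_cnj: "fourier_coeff (\<lambda>u. cnj (f u)) n = cnj (fourier_coeff f (- n))"
proof -
  have "(LINT u|circle_measure. cnj (f u) * mode (- n) u) = (LINT u|circle_measure. cnj (f u * mode n u))"
    by (simp add: cnj_mode)
  then show ?thesis by (simp only: fourier_coeff_eq Bochner_Integration.integral_cnj) simp
qed

lemma fourier_coeff_mult_mode: "fourier_coeff (\<lambda>u. f u * mode m u) n = fourier_coeff f (n - m)"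
  by (simp add: fourier_coeff_eq mult.assoc mode_mult_mode algebra_simps)

lemma fourier_coeff_cong_AE:
  assumes "AE u in circle_measure. f u = g u"
    "f \<in> borel_measurable circle_measure" "g \<in> borel_measurable circle_measure"
  shows "fourier_coeff f n = fourier_coeff g n"
proof -
  have "(LINT u|circle_measure. f u * mode (- n) u) = (LINT u|circle_measure. g u * mode (- n) u)"
    using assms by (intro integral_cong_AE) auto
  then show ?thesis by (simp add: fourier_coeff_eq)
qed

text \<open>
  The integral of \<open>(\<bar>f\<bar> - t \<bar>g\<bar>)\<^sup>2\<close> is a nonnegative quadratic polynomial in \<open>t\<close>.
\<close>

lemma Cauchy_Schwarz_circle:
  assumes f: "square_integrable f" and g: "square_integrable g"
  shows "cmod (LINT u|circle_measure. f u * g u)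
    \<le> sqrt (LINT u|circle_measure. (cmod (f u))\<^sup>2) * sqrt (LINT u|circle_measure. (cmod (g u))\<^sup>2)"
proof -
  define a where "a = (LINT u|circle_measure. (cmod (f u))\<^sup>2)"
  define b where "b = (LINT u|circle_measure. (cmod (g u))\<^sup>2)"
  define m where "m = (LINT u|circle_measure. cmod (f u) * cmod (g u))"
  have ifg: "integrable circle_measure (\<lambda>u. cmod (f u) * cmod (g u))"
    by (rule square_integrable_norm_mult[OF f g])
  have quad: "0 \<le> a - 2 * t * m + t\<^sup>2 * b" for t
  proof -
    have "0 \<le> (LINT u|circle_measure. (cmod (f u) - t * cmod (g u))\<^sup>2)"
      by (rule integral_nonneg_AE) simp
    also have "(\<lambda>u. (cmod (f u) - t * cmod (g u))\<^sup>2) =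
        (\<lambda>u. (cmod (f u))\<^sup>2 - 2 * t * (cmod (f u) * cmod (g u)) + t\<^sup>2 * (cmod (g u))\<^sup>2)"
      by (simp add: fun_eq_iff power2_eq_square algebra_simps)
    also have "(LINT u|circle_measure. \<dots> u) = a - 2 * t * m + t\<^sup>2 * b"
      using ifg square_integrable_norm_sq[OF f] square_integrable_norm_sq[OF g]
      by (simp add: a_def b_def m_def)
    finally show ?thesis .
  qed
  have b0: "0 \<le> b" and m0: "0 \<le> m" and a0: "0 \<le> a" by (simp_all add: a_def b_def m_def)
  have "m\<^sup>2 \<le> a * b"
  proof (cases "b = 0")
    case True
    then have "2 * t * m \<le> a" for t using quad[of t] by simp
    from this[of "(a + 1) / (2 * m)"] have "m = 0" by (cases "m = 0") auto
    then show ?thesis using a0 b0 by simp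
  next
    case False
    then have "b > 0" using b0 by simp
    \<comment> \<open>the minimum of the quadratic is attained at \<open>t = m / b\<close>\<close>
    have "0 \<le> (a - 2 * (m / b) * m + (m / b)\<^sup>2 * b) * b"
      using quad[of "m / b"] b0 by simp
    also have "\<dots> = a * b - m\<^sup>2" using \<open>b > 0\<close> by (simp add: field_simps power2_eq_square)
    finally show ?thesis by simp
  qed
  then have "m \<le> sqrt a * sqrt b"
    using real_le_rsqrt by (simp add: real_sqrt_mult[symmetric])
  moreover have "cmod (LINT u|circle_measure. f u * g u) \<le> m"
    unfolding m_def norm_mult[symmetric] by (rule integral_norm_bound)
  ultimately show ?thesis by (simp add: a_def b_def)
qed

lemma norm_sq_diff_mode:
  assumes g: "square_integrable g"
  shows "(LINT u|circle_measure. (cmod (g u - a * mode n u))\<^sup>2) =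
    (LINT u|circle_measure. (cmod (g u))\<^sup>2) - 2 * pi * (cmod (fourier_coeff g n))\<^sup>2
     + 2 * pi * (cmod (fourier_coeff g n - a))\<^sup>2"
proof -
  define p where "p = fourier_coeff g n"
  have ig: "integrable circle_measure (\<lambda>u. g u * mode (- n) u)"
    by (intro integrable_mult_mode square_integrable_integrable g)
  have pI: "(LINT u|circle_measure. g u * mode (- n) u) = 2 * of_real pi * p"
    by (simp add: p_def fourier_coeff_eq)
  define r where "r = (\<lambda>u. Re (cnj a * (g u * mode (- n) u)))"
  have "(cmod (g u - a * mode n u))\<^sup>2 = (cmod (g u))\<^sup>2 - 2 * r u + (cmod a)\<^sup>2" for u
  proof -
    have "(cmod (g u - a * mode n u))\<^sup>2 = (cmod (g u))\<^sup>2 - 2 * Re (g u * cnj (a * mode n u)) + (cmod (a * mode n u))\<^sup>2"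
      by (simp only: cmod_power2) (simp add: power2_eq_square algebra_simps)
    also have "g u * cnj (a * mode n u) = cnj a * (g u * mode (- n) u)"
      by (simp add: cnj_mode)
    finally show ?thesis by (simp add: norm_mult r_def)
  qed
  then have "(LINT u|circle_measure. (cmod (g u - a * mode n u))\<^sup>2) =
     (LINT u|circle_measure. (cmod (g u))\<^sup>2 - 2 * r u + (cmod a)\<^sup>2)"
    by simp
  also have "\<dots> = (LINT u|circle_measure. (cmod (g u))\<^sup>2) - 2 * Re (cnj a * (2 * of_real pi * p)) + 2 * pi * (cmod a)\<^sup>2"
  proof -
    have i: "integrable circle_measure (\<lambda>u. cnj a * (g u * mode (- n) u))"
      using ig by simp
    have "(LINT u|circle_measure. r u) = Re (cnj a * (2 * of_real pi * p))"
      unfolding r_def by (simp only: integral_Re[OF i] integral_mult_right_zero pI)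
    moreover have "integrable circle_measure r"
      unfolding r_def by (rule integrable_Re[OF i])
    moreover have "integrable circle_measure (\<lambda>u. (cmod a)\<^sup>2)"
      by (rule finite_measure.integrable_const[OF finite_measure_circle])
    moreover have "(LINT u|circle_measure. (cmod a)\<^sup>2) = 2 * pi * (cmod a)\<^sup>2"
      using measure_circle by simp
    ultimately show ?thesis
      using square_integrable_norm_sq[OF g] by simp
  qed
  also have "\<dots> = (LINT u|circle_measure. (cmod (g u))\<^sup>2) - 2 * pi * (cmod p)\<^sup>2 + 2 * pi * (cmod (p - a))\<^sup>2"
    by (simp only: cmod_power2) (simp add: power2_eq_square algebra_simps)
  finally show ?thesis by (simp add: p_def)
qed

lemma integrable_finite_sum_modes: "integrable circle_measure (\<lambda>u. \<Sum>k\<in>F. a k * mode k u)"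
  by (intro square_integrable_integrable square_integrable_sum square_integrable_cmult square_integrable_mode)

lemma fourier_coeff_sum_modes:
  "finite F \<Longrightarrow> fourier_coeff (\<lambda>u. \<Sum>k\<in>F. a k * mode k u) n = (if n \<in> F then a n else 0)"
proof (induction F rule: finite_induct)
  case empty
  show ?case using fourier_coeff_const[of 0 n] by simp
next
  case (insert k F)
  have "fourier_coeff (\<lambda>u. \<Sum>k\<in>insert k F. a k * mode k u) n =
     fourier_coeff (\<lambda>u. a k * mode k u + (\<Sum>k\<in>F. a k * mode k u)) n"
    using insert by simp
  also have "\<dots> = fourier_coeff (\<lambda>u. a k * mode k u) n + (if n \<in> F then a n else 0)"
    by (subst fourier_coeff_add) (auto simp: insert integrable_finite_sum_modes
        intro!: square_integrable_integrable square_integrable_cmult square_integrable_mode)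
  finally show ?case using insert by (auto simp: fourier_coeff_cmult fourier_coeff_mode)
qed

text \<open>
  By orthogonality each mode contributes separately to the squared distance, so one mode at a time can
  be subtracted. The choice \<open>a = fourier_coeff f\<close> gives Bessel's inequality, and \<open>f = 0\<close> gives
  Parseval's identity for finite sums.
\<close>

lemma norm_sq_diff_sum_modes:
  assumes f: "square_integrable f" and F: "finite F"
  shows "(LINT u|circle_measure. (cmod (f u - (\<Sum>k\<in>F. a k * mode k u)))\<^sup>2) =
    (LINT u|circle_measure. (cmod (f u))\<^sup>2)
      - 2 * pi * (\<Sum>k\<in>F. (cmod (fourier_coeff f k))\<^sup>2)
      + 2 * pi * (\<Sum>k\<in>F. (cmod (fourier_coeff f k - a k))\<^sup>2)"
  using F
proof (induction F rule: finite_induct)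
  case (insert n F)
  define g where "g = (\<lambda>u. f u - (\<Sum>k\<in>F. a k * mode k u))"
  have g: "square_integrable g"
    unfolding g_def by (intro square_integrable_diff f square_integrable_sum square_integrable_cmult square_integrable_mode)
  have c: "fourier_coeff g n = fourier_coeff f n"
    unfolding g_def by (subst fourier_coeff_diff)
      (auto simp: insert f integrable_finite_sum_modes fourier_coeff_sum_modes square_integrable_integrable)
  have "(\<lambda>u. f u - (\<Sum>k\<in>insert n F. a k * mode k u)) = (\<lambda>u. g u - a n * mode n u)"
    using insert by (simp add: g_def algebra_simps)
  then show ?case
    using norm_sq_diff_mode[OF g, of "a n" n] insert unfolding c
    by (simp add: g_def algebra_simps)
qed simp

lemma Bessel_inequality:
  assumes f: "square_integrable f" and F: "finite F"
  shows "2 * pi * (\<Sum>k\<in>F. (cmod (fourier_coeff f k))\<^sup>2) \<le> (LINT u|circle_measure. (cmod (f u))\<^sup>2)"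
proof -
  have "0 \<le> (LINT u|circle_measure. (cmod (f u - (\<Sum>k\<in>F. fourier_coeff f k * mode k u)))\<^sup>2)"
    by simp
  then show ?thesis unfolding norm_sq_diff_sum_modes[OF assms] by simp
qed

lemma norm_sq_sum_modes:
  "finite F \<Longrightarrow> (LINT u|circle_measure. (cmod (\<Sum>k\<in>F. a k * mode k u))\<^sup>2) = 2 * pi * (\<Sum>k\<in>F. (cmod (a k))\<^sup>2)"
  using norm_sq_diff_sum_modes[OF square_integrable_const[of 0], of F a]
  by (simp add: fourier_coeff_const)

lemma Bessel_summable:
  assumes f: "square_integrable f"
  shows "(\<lambda>n. (cmod (fourier_coeff f n))\<^sup>2) summable_on UNIV"
proof (rule nonneg_bdd_above_summable_on)
  show "bdd_above (sum (\<lambda>n. (cmod (fourier_coeff f n))\<^sup>2) ` {F. F \<subseteq> UNIV \<and> finite F})"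
  proof (rule bdd_aboveI2)
    fix F :: "int set" assume "F \<in> {F. F \<subseteq> UNIV \<and> finite F}"
    then show "(\<Sum>k\<in>F. (cmod (fourier_coeff f k))\<^sup>2) \<le> (LINT u|circle_measure. (cmod (f u))\<^sup>2) / (2 * pi)"
      using Bessel_inequality[OF f, of F] by (simp add: field_simps)
  qed
qed simp

section \<open>Integrable functions are determined by their Fourier coefficients\<close>

text \<open>
  Multiplication by \<open>cos\<close> or \<open>sin\<close> shifts Fourier coefficients by \<open>\<plusminus>1\<close>. Hence the integrable functions
  with vanishing coefficients are stable under multiplication by polynomials in \<open>cos u\<close> and \<open>sin u\<close>;
  stability, rather than orthogonality alone, makes the induction pass through products.
\<close>

lemma zero_coeffs_mult_polynomial:
  assumes "real_polynomial_function q" "integrable circle_measure f" "\<And>n. fourier_coeff f n = 0"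
  shows "integrable circle_measure (\<lambda>u. f u * of_real (q (cis u))) \<and>
    (\<forall>n. fourier_coeff (\<lambda>u. f u * of_real (q (cis u))) n = 0)"
  using assms
proof (induction q arbitrary: f rule: real_polynomial_function.induct)
  case (linear l f)
  interpret l: bounded_linear l by fact
  define a where "a = (complex_of_real (l 1) - \<i> * of_real (l \<i>)) / 2"
  define b where "b = (complex_of_real (l 1) + \<i> * of_real (l \<i>)) / 2"
  have l: "complex_of_real (l (cis u)) = a * mode 1 u + b * mode (-1) u" for u
  proof -
    have "cis u = cos u *\<^sub>R 1 + sin u *\<^sub>R \<i>" by (simp add: complex_eq_iff)
    then have "l (cis u) = cos u * l 1 + sin u * l \<i>" by (simp only: l.add l.scaleR real_scaleR_def)
    then show ?thesis by (simp add: a_def b_def mode_def complex_eq_iff field_simps)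
  qed
  have eq: "(\<lambda>u. f u * of_real (l (cis u))) = (\<lambda>u. a * (f u * mode 1 u) + b * (f u * mode (-1) u))"
    by (simp add: l fun_eq_iff algebra_simps)
  have i: "integrable circle_measure (\<lambda>u. a * (f u * mode 1 u))" "integrable circle_measure (\<lambda>u. b * (f u * mode (-1) u))"
    by (intro integrable_mult_right integrable_mult_mode linear)+
  show ?case
    unfolding eq using i by (simp only: fourier_coeff_add fourier_coeff_cmult fourier_coeff_mult_mode linear)
      simp
next
  case (const c f)
  then show ?case using fourier_coeff_cmult[of "of_real c" f] by (simp add: mult.commute)
next
  case (add p q f)
  then show ?case by (simp add: distrib_left fourier_coeff_add)
next
  case (mult p q f)
  from mult.IH(2)[OF mult.IH(1)[OF mult.prems, THEN conjunct1]] mult.IH(1)[OF mult.prems]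
  show ?case by (simp add: mult.assoc)
qed

text \<open>Continuous test functions on the circle are uniform limits of trigonometric polynomials.\<close>

lemma zero_coeffs_orthogonal_continuous:
  fixes F :: "complex \<Rightarrow> real"
  assumes F: "continuous_on UNIV F" and f: "integrable circle_measure f" "\<And>n. fourier_coeff f n = 0"
  shows "(LINT u|circle_measure. f u * of_real (F (cis u))) = 0"
proof -
  define I where "I = (LINT u|circle_measure. f u * of_real (F (cis u)))"
  define B where "B = (LINT u|circle_measure. cmod (f u))"
  have mF: "(\<lambda>u. complex_of_real (F (cis u))) \<in> borel_measurable circle_measure"
    by (intro continuous_imp_measurable_circle continuous_intros continuous_on_compose2[OF F]) auto
  have "compact (F ` sphere 0 1)"
    by (intro compact_continuous_image continuous_on_subset[OF F]) auto
  then have "bounded (F ` sphere 0 1)" by (rule compact_imp_bounded)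
  then obtain C where C: "\<And>x. x \<in> sphere 0 1 \<Longrightarrow> \<bar>F x\<bar> \<le> C" unfolding bounded_iff by (metis imageI real_norm_def)
  have iF: "integrable circle_measure (\<lambda>u. f u * of_real (F (cis u)))"
    by (rule integrable_mult_bounded[OF f(1) mF, of C]) (auto intro: C)
  have "cmod I \<le> e * B" if e: "e > 0" for e
  proof -
    obtain q where q: "real_polynomial_function q" "\<And>x. x \<in> sphere 0 1 \<Longrightarrow> \<bar>F x - q x\<bar> < e"
      using Stone_Weierstrass_real_polynomial_function[OF _ continuous_on_subset[OF F] e, of "sphere 0 1"] by auto
    note zq = zero_coeffs_mult_polynomial[OF q(1) f]
    have "I = I - (LINT u|circle_measure. f u * of_real (q (cis u)))"
      using zq fourier_coeff_eq[of "\<lambda>u. f u * of_real (q (cis u))" 0] by auto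
    also have "\<dots> = (LINT u|circle_measure. f u * of_real (F (cis u)) - f u * of_real (q (cis u)))"
      using zq iF by (simp add: I_def)
    also have "cmod \<dots> \<le> (LINT u|circle_measure. cmod (f u * of_real (F (cis u)) - f u * of_real (q (cis u))))"
      by (rule integral_norm_bound)
    also have "\<dots> \<le> (LINT u|circle_measure. e * cmod (f u))"
    proof (rule integral_mono)
      show "integrable circle_measure (\<lambda>u. cmod (f u * of_real (F (cis u)) - f u * of_real (q (cis u))))"
        using zq iF by auto
      show "cmod (f u * of_real (F (cis u)) - f u * of_real (q (cis u))) \<le> e * cmod (f u)" for u
      proof -
        have "\<bar>F (cis u) - q (cis u)\<bar> \<le> e" using q(2)[of "cis u"] by auto
        then have "cmod (f u) * cmod (of_real (F (cis u) - q (cis u))) \<le> cmod (f u) * e"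
          by (intro mult_left_mono) (auto simp del: of_real_diff)
        then show ?thesis
          by (simp add: norm_mult[symmetric] right_diff_distrib mult.commute)
      qed
    qed (use f in auto)
    finally show ?thesis by (simp add: B_def)
  qed
  then have "cmod I \<le> 0 * B"
    by (intro tendsto_lowerbound[of "\<lambda>e. e * B" _ "at_right 0"])
      (auto intro!: tendsto_eq_intros eventually_at_right_less[THEN eventually_mono])
  then show ?thesis by (simp add: I_def)
qed

text \<open>
  The indicator of a closed set is a bounded pointwise limit of continuous functions of the distance to
  the set.
\<close>

lemma zero_coeffs_orthogonal_closed:
  assumes C: "closed (C :: complex set)" and f: "integrable circle_measure f" "\<And>n. fourier_coeff f n = 0"
  shows "(LINT u|circle_measure. f u * indicator C (cis u)) = 0"
proof (cases "C = {}")
  case False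
  define F where "F k z = max 0 (1 - real k * infdist z C)" for k z
  have cF: "continuous_on UNIV (F k)" for k
    unfolding F_def by (intro continuous_intros)
  have F01: "0 \<le> F k z" "F k z \<le> 1" for k z by (auto simp: F_def infdist_nonneg)
  have lim: "(\<lambda>k. F k z) \<longlonglongrightarrow> indicator C z" for z
  proof (cases "z \<in> C")
    case True
    then show ?thesis by (simp add: F_def)
  next
    case z: False
    then have d: "infdist z C > 0"
      using in_closed_iff_infdist_zero[OF C False, of z] infdist_nonneg[of z C] by linarith
    obtain N :: nat where N: "1 / infdist z C < real N" using reals_Archimedean2 by blast
    have "eventually (\<lambda>k. F k z = 0) sequentially"
      using eventually_ge_at_top[of N]
    proof eventually_elim
      case (elim k)
      then have "1 / infdist z C \<le> real k" using N by linarith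
      then show ?case using d by (simp add: F_def field_simps)
    qed
    then show ?thesis using z by (simp add: tendsto_eventually)
  qed
  have mF: "(\<lambda>u. complex_of_real (F k (cis u))) \<in> borel_measurable circle_measure" for k
    by (intro continuous_imp_measurable_circle continuous_intros continuous_on_compose2[OF cF]) auto
  have limc: "(\<lambda>k. f u * of_real (F k (cis u))) \<longlonglongrightarrow> f u * indicator C (cis u)" for u
  proof -
    have "(\<lambda>k. f u * of_real (F k (cis u))) \<longlonglongrightarrow> f u * of_real (indicator C (cis u))"
      by (intro tendsto_intros lim)
    then show ?thesis by (simp add: indicator_def of_bool_def split: if_splits)
  qed
  have "(\<lambda>k. LINT u|circle_measure. f u * of_real (F k (cis u))) \<longlonglongrightarrow> (LINT u|circle_measure. f u * indicator C (cis u))"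
  proof (rule integral_dominated_convergence[where w="\<lambda>u. cmod (f u)"])
    show "(\<lambda>u. f u * of_real (F k (cis u))) \<in> borel_measurable circle_measure" for k
      using f mF by auto
    show "(\<lambda>u. f u * indicator C (cis u)) \<in> borel_measurable circle_measure"
      by (rule borel_measurable_LIMSEQ_metric[where f="\<lambda>k u. f u * of_real (F k (cis u))"])
        (use f mF limc in auto)
    show "AE u in circle_measure. cmod (f u * of_real (F k (cis u))) \<le> cmod (f u)" for k
      using F01[of k] by (intro AE_I2) (simp add: norm_mult mult_left_le)
  qed (use f limc in auto)
  moreover have "(LINT u|circle_measure. f u * of_real (F k (cis u))) = 0" for k
    by (rule zero_coeffs_orthogonal_continuous[OF cF f])
  ultimately show ?thesis by (simp add: LIMSEQ_const_iff)
qed simp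

lemma cis_image_mem_iff:
  assumes "T \<subseteq> {-pi<..<pi}" "u \<in> {-pi<..<pi}"
  shows "cis u \<in> cis ` T \<longleftrightarrow> u \<in> T"
proof -
  have "v = u" if "cis u = cis v" "v \<in> T" for v
proof -
    have "v \<in> {-pi<..<pi}" using that assms by auto
    then have "Arg (cis v) = v" "Arg (cis u) = u" using assms(2) Arg_cis[of v] Arg_cis[of u] by auto
    then show ?thesis using that(1) by simp
  qed
  then show ?thesis by auto
qed

text \<open>
  By inner regularity, a set of positive measure where \<open>Re f > 0\<close> would contain a closed set \<open>T\<close> of
  positive measure, and the integral of \<open>Re f\<close> over \<open>T\<close> would be positive. The endpoints are removed
  because \<open>cis\<close> identifies them.
\<close>

lemma zero_coeffs_Re_nonpos:
  assumes f: "integrable circle_measure f" "\<And>n. fourier_coeff f n = 0"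
  shows "AE u in circle_measure. Re (f u) \<le> 0"
proof -
  define E where "E = {u \<in> {-pi..pi}. Re (f u) > 0} \<inter> {-pi<..<pi}"
  have mE: "E \<in> sets lebesgue"
  proof -
    have "{u \<in> space circle_measure. Re (f u) > 0} \<in> sets circle_measure"
      using f(1) by measurable
    then have "{u \<in> {-pi..pi}. Re (f u) > 0} \<in> sets lebesgue"
      by (simp add: sets_restrict_space_iff space_restrict_space)
    then have "{u \<in> {-pi..pi}. Re (f u) > 0} \<inter> {-pi<..<pi} \<in> sets lebesgue"
      by (rule sets.Int) auto
    then show ?thesis unfolding E_def .
  qed
  have ends: "{-pi, pi} \<in> null_sets lebesgue"
    by (intro null_sets_completionI finite_imp_null_set_lborel) simp
  have small: "emeasure lebesgue E \<le> ennreal e" if e: "e > 0" for e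
  proof -
    obtain T where T: "closed T" "T \<subseteq> E" "E - T \<in> lmeasurable" "emeasure lebesgue (E - T) < ennreal e"
      using sets_lebesgue_inner_closed[OF mE e] by blast
    have "bounded T" using bounded_subset[OF bounded_closed_interval, of T "-pi" pi] T(2) by (force simp: E_def)
    then have "compact T" using T by (simp add: compact_eq_bounded_closed)
    then have "closed (cis ` T)"
      by (intro compact_imp_closed compact_continuous_image continuous_intros)
    from zero_coeffs_orthogonal_closed[OF this f]
    have z: "(LINT u|circle_measure. f u * indicator (cis ` T) (cis u)) = 0" .
    have mT: "T \<in> sets lebesgue" using T(1) by (intro sets_completionI_sets) simp
    have ae: "AE u in circle_measure. f u * indicator (cis ` T) (cis u) = f u * indicator T u"
    proof -
      have "AE u in circle_measure. u \<noteq> -pi \<and> u \<noteq> pi"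
        using AE_circle_neq[of "-pi"] AE_circle_neq[of pi] by eventually_elim auto
      then show ?thesis
      proof (rule AE_mp, intro AE_I2 impI)
        fix u assume "u \<in> space circle_measure" and "u \<noteq> -pi \<and> u \<noteq> pi"
        then have u: "u \<in> {-pi<..<pi}" by (auto simp: space_restrict_space)
        have "T \<subseteq> {-pi<..<pi}" using T(2) by (auto simp: E_def)
        from cis_image_mem_iff[OF this u] 
        show "f u * indicator (cis ` T) (cis u) = f u * indicator T u"
          by (simp add: indicator_def)
      qed
    qed
    have mTc: "T \<in> sets circle_measure"
      using mT T(2) by (auto simp: sets_restrict_space_iff E_def)
    have iT: "integrable circle_measure (\<lambda>u. f u * indicator T u)"
      by (rule integrable_mult_bounded[OF f(1), of _ 1]) (use mTc in \<open>auto simp: indicator_def\<close>)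
    have "(LINT u|circle_measure. f u * indicator T u) = 0"
      unfolding z[symmetric]
    proof (rule integral_cong_AE)
      show "(\<lambda>u. f u * indicator (cis ` T) (cis u)) \<in> borel_measurable circle_measure"
      proof -
        have "(\<lambda>u. indicator (cis ` T) (cis u) :: complex) \<in> borel_measurable circle_measure"
          by (rule measurable_compose[OF continuous_imp_measurable_circle])
            (use \<open>closed (cis ` T)\<close> in \<open>auto intro!: continuous_intros\<close>)
        then show ?thesis using f(1) by auto
      qed
    qed (use iT ae in auto)
    then have "(LINT u|circle_measure. Re (f u * indicator T u)) = 0"
      using integral_Re[OF iT] by simp
    moreover have "0 \<le> Re (f u * indicator T u)" for u
      using T(2) by (auto simp: indicator_def E_def)
    ultimately have "AE u in circle_measure. Re (f u * indicator T u) = 0"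
      using integral_nonneg_eq_0_iff_AE[OF integrable_Re[OF iT]] by auto
    then have "AE u in circle_measure. u \<notin> T"
      by (rule AE_mp) (use T(2) in \<open>auto simp: E_def indicator_def intro!: AE_I2\<close>)
    then have "AE u in lebesgue. u \<in> {-pi..pi} \<longrightarrow> u \<notin> T"
      by (simp add: AE_restrict_space_iff)
    then have "AE u in lebesgue. u \<notin> T"
      by (rule eventually_mono) (use T(2) in \<open>auto simp: E_def\<close>)
    then have "emeasure lebesgue T = 0"
      using AE_iff_measurable[OF mT, of "\<lambda>u. u \<notin> T"] by auto
    moreover have "emeasure lebesgue E \<le> emeasure lebesgue (E - T) + emeasure lebesgue T"
      using T(2) mE mT emeasure_subadditive[of "E - T" lebesgue T] by (simp add: Un_absorb2)
    ultimately show ?thesis using T(4) by auto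
  qed
  have "emeasure lebesgue E \<le> 0"
    by (rule ennreal_le_epsilon) (simp add: small)
  then have "E \<in> null_sets lebesgue" using mE by (simp add: null_sets_def)
  from AE_not_in[OF this] AE_not_in[OF ends]
  have "AE u in lebesgue. u \<in> {-pi..pi} \<longrightarrow> Re (f u) \<le> 0"
    by eventually_elim (auto simp: E_def)
  then show ?thesis by (simp add: AE_restrict_space_iff)
qed

theorem fourier_coeff_unique:
  assumes f: "integrable circle_measure f" and g: "integrable circle_measure g"
    and eq: "\<And>n. fourier_coeff f n = fourier_coeff g n"
  shows "AE u in circle_measure. f u = g u"
proof -
  define d where "d u = f u - g u" for u
  have d: "integrable circle_measure d" "\<And>n. fourier_coeff d n = 0"
    using assms by (auto simp: d_def[abs_def] fourier_coeff_diff)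
  \<comment> \<open>rotating by \<open>c = \<plusminus>1, \<plusminus>\<i>\<close> bounds the real and imaginary parts from both sides\<close>
  have "AE u in circle_measure. Re (c * d u) \<le> 0" for c
    by (rule zero_coeffs_Re_nonpos) (use d in \<open>auto simp: fourier_coeff_cmult\<close>)
  from this[of 1] this[of "-1"] this[of \<i>] this[of "-\<i>"]
  show ?thesis by eventually_elim (simp add: d_def complex_eq_iff)
qed

section \<open>The Riesz-Fischer theorem and products\<close>

definition trig_sum :: "(int \<Rightarrow> complex) \<Rightarrow> nat \<Rightarrow> real \<Rightarrow> complex" where
  "trig_sum a N u = (\<Sum>n\<in>{- int N..int N}. a n * mode n u)"

lemma trig_sum_square_integrable: "square_integrable (trig_sum a N)" 
  unfolding trig_sum_def
  by (intro square_integrable_sum square_integrable_cmult square_integrable_mode)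

lemma L1_le_L2:
  assumes "square_integrable f"
  shows "(LINT u|circle_measure. cmod (f u)) \<le> sqrt (2 * pi) * sqrt (LINT u|circle_measure. (cmod (f u))\<^sup>2)"
proof -
  have "square_integrable (\<lambda>u. of_real (cmod (f u)))"
    using assms by (auto simp: square_integrable_def)
  from Cauchy_Schwarz_circle[OF this square_integrable_const[of 1]] show ?thesis
    using measure_circle by (simp add: mult.commute)
qed

text \<open>
  Convergence in \<open>L\<^sup>2\<close> implies weak convergence. Taking \<open>g\<close> to be a mode, Fourier coefficients pass to
  \<open>L\<^sup>2\<close> limits; taking an indicator function, integrals over subintervals do.
\<close>

lemma L2_limit_mult:
  assumes F: "\<And>N. square_integrable (F N)" and f: "square_integrable f" and g: "square_integrable g"
    and lim: "(\<lambda>N. LINT u|circle_measure. (cmod (f u - F N u))\<^sup>2) \<longlonglongrightarrow> 0"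
  shows "(\<lambda>N. LINT u|circle_measure. F N u * g u) \<longlonglongrightarrow> (LINT u|circle_measure. f u * g u)"
proof -
  define B where "B = sqrt (LINT u|circle_measure. (cmod (g u))\<^sup>2)"
  have "(\<lambda>N. (LINT u|circle_measure. f u * g u) - (LINT u|circle_measure. F N u * g u)) \<longlonglongrightarrow> 0"
  proof (rule Lim_null_comparison)
    show "eventually (\<lambda>N. cmod ((LINT u|circle_measure. f u * g u) - (LINT u|circle_measure. F N u * g u))
       \<le> sqrt (LINT u|circle_measure. (cmod (f u - F N u))\<^sup>2) * B) sequentially"
    proof (intro always_eventually allI)
      fix N
      have "(LINT u|circle_measure. f u * g u) - (LINT u|circle_measure. F N u * g u)
          = (LINT u|circle_measure. (f u - F N u) * g u)"
        by (simp add: left_diff_distrib square_integrable_mult F f g)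
      then show "cmod ((LINT u|circle_measure. f u * g u) - (LINT u|circle_measure. F N u * g u))
       \<le> sqrt (LINT u|circle_measure. (cmod (f u - F N u))\<^sup>2) * B"
        using Cauchy_Schwarz_circle[OF square_integrable_diff[OF f F] g] by (simp add: B_def)
    qed
    show "(\<lambda>N. sqrt (LINT u|circle_measure. (cmod (f u - F N u))\<^sup>2) * B) \<longlonglongrightarrow> 0"
      using tendsto_mult[OF tendsto_real_sqrt[OF lim] tendsto_const[of B]] by simp
  qed
  from tendsto_diff[OF tendsto_const[of "LINT u|circle_measure. f u * g u"] this] show ?thesis by simp
qed

lemma fourier_coeff_L2_limit:
  assumes f: "square_integrable f"
    and lim: "(\<lambda>N. LINT u|circle_measure. (cmod (f u - trig_sum a N u))\<^sup>2) \<longlonglongrightarrow> 0"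
  shows "fourier_coeff f n = a n"
proof -
  have "(\<lambda>N. fourier_coeff (trig_sum a N) n) \<longlonglongrightarrow> fourier_coeff f n"
    unfolding fourier_coeff_eq
    by (intro tendsto_divide L2_limit_mult[OF trig_sum_square_integrable f square_integrable_mode lim]) auto
  moreover have "eventually (\<lambda>N. fourier_coeff (trig_sum a N) n = a n) sequentially"
    using eventually_ge_at_top[of "nat \<bar>n\<bar>"]
    by eventually_elim (auto simp: trig_sum_def[abs_def] fourier_coeff_sum_modes)
  ultimately show ?thesis
    by (intro LIMSEQ_unique[OF _ tendsto_eventually])
qed

text \<open>
  The partial sums are Cauchy in \<open>L\<^sup>2\<close>. Along a subsequence whose successive differences have \<open>L\<^sup>2\<close>
  norms decaying geometrically, the differences are absolutely summable almost everywhere, so this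
  subsequence converges pointwise almost everywhere; Fatou's lemma bounds the distance from the limit
  to each partial sum.
\<close>

theorem Riesz_Fischer:
  assumes a: "(\<lambda>n. (cmod (a n))\<^sup>2) summable_on UNIV"
  obtains g where "g \<in> L2_circle"
    "(\<lambda>N. LINT u|circle_measure. (cmod (g u - trig_sum a N u))\<^sup>2) \<longlonglongrightarrow> 0"
proof -
  let ?S = "trig_sum a"
  define A where "A N = (\<Sum>n\<in>{- int N..int N}. (cmod (a n))\<^sup>2)" for N
  have inc: "incseq A" by (rule incseq_SucI) (auto simp: A_def intro!: sum_mono2)
  have "A N \<le> infsum (\<lambda>n. (cmod (a n))\<^sup>2) UNIV" for N
    unfolding A_def by (rule finite_sum_le_infsum[OF a]) auto
  then obtain L where "A \<longlonglongrightarrow> L" "\<forall>N. A N \<le> L"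
    using incseq_convergent[OF inc, of "infsum (\<lambda>n. (cmod (a n))\<^sup>2) UNIV"] by auto
  then have L: "A \<longlonglongrightarrow> L" "A N \<le> L" for N by auto
  have dist: "(LINT u|circle_measure. (cmod (?S N u - ?S M u))\<^sup>2) \<le> 2 * pi * (L - A M)" if "M \<le> N" for M N
  proof -
    have sub: "{- int M..int M} \<subseteq> {- int N..int N}" using that by auto
    have e: "?S N u - ?S M u = (\<Sum>n\<in>{- int N..int N} - {- int M..int M}. a n * mode n u)" for u
      unfolding trig_sum_def using sub by (simp add: sum_diff)
    have "(LINT u|circle_measure. (cmod (?S N u - ?S M u))\<^sup>2)
        = 2 * pi * (\<Sum>n\<in>{- int N..int N} - {- int M..int M}. (cmod (a n))\<^sup>2)"
      unfolding e by (rule norm_sq_sum_modes) simp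
    also have "\<dots> = 2 * pi * (A N - A M)"
      unfolding A_def by (subst sum_diff[OF _ sub]) auto
    finally have "(LINT u|circle_measure. (cmod (?S N u - ?S M u))\<^sup>2) = 2 * pi * (A N - A M)" .
    then show ?thesis using L(2)[of N] by simp
  qed
  have "\<exists>N. \<forall>n\<ge>N. L - A n \<le> (1/4)^k" for k
  proof -
    have "eventually (\<lambda>n. A n > L - (1/4)^k) sequentially"
      by (rule order_tendstoD(1)[OF L(1)]) simp
    then show ?thesis unfolding eventually_sequentially by (force intro: less_imp_le)
  qed
  then obtain N where N: "\<And>k n. n \<ge> N k \<Longrightarrow> L - A n \<le> (1/4)^k" by metis
  \<comment> \<open>adding \<open>k\<close> makes the indices unbounded, summing the \<open>N j\<close> makes them monotone\<close>
  define r where "r k = k + (\<Sum>j\<le>k. N j)" for k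
  have r: "r k \<le> r (Suc k)" "k \<le> r k" "L - A (r k) \<le> (1/4)^k" for k
  proof -
    have "N k \<le> (\<Sum>j\<le>k. N j)" by (rule member_le_sum) auto
    then show "L - A (r k) \<le> (1/4)^k" by (intro N) (simp add: r_def)
  qed (auto simp: r_def)
  define d where "d k u = ?S (r (Suc k)) u - ?S (r k) u" for k u
  have sqd: "square_integrable (d k)" for k
    unfolding d_def by (intro square_integrable_diff trig_sum_square_integrable)
  have d1: "(LINT u|circle_measure. cmod (d k u)) \<le> 2 * pi * (1/2)^k" for k
  proof -
    have "(LINT u|circle_measure. (cmod (d k u))\<^sup>2) \<le> 2 * pi * (L - A (r k))"
      unfolding d_def by (rule dist[OF r(1)])
    also have "\<dots> \<le> 2 * pi * ((1/2)^k)\<^sup>2"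
    proof (intro mult_left_mono)
      have "((1/2)^k)\<^sup>2 = ((1/4)^k :: real)"
        by (simp add: power2_eq_square flip: power_mult_distrib)
      then show "L - A (r k) \<le> ((1/2)^k)\<^sup>2" using r(3)[of k] by simp
    qed simp
    finally have "sqrt (LINT u|circle_measure. (cmod (d k u))\<^sup>2) \<le> sqrt (2 * pi) * (1/2)^k"
      by (intro real_le_lsqrt) (auto simp: power_mult_distrib)
    then have "sqrt (2 * pi) * sqrt (LINT u|circle_measure. (cmod (d k u))\<^sup>2) \<le> sqrt (2 * pi) * (sqrt (2 * pi) * (1/2)^k)"
      by (intro mult_left_mono) auto
    also have "\<dots> = 2 * pi * (1/2)^k" by simp
    finally show ?thesis using L1_le_L2[OF sqd[of k]] by linarith
  qed
  have id: "integrable circle_measure (\<lambda>u. cmod (d k u))" for k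
    using square_integrable_integrable[OF sqd] by (rule integrable_norm)
  have "AE u in circle_measure. summable (\<lambda>k. cmod (d k u))"
  proof -
    have "(\<integral>\<^sup>+u. (\<Sum>k. ennreal (cmod (d k u))) \<partial>circle_measure) = (\<Sum>k. \<integral>\<^sup>+u. ennreal (cmod (d k u)) \<partial>circle_measure)"
      by (intro nn_integral_suminf) (use id in auto)
    also have "\<dots> = (\<Sum>k. ennreal (LINT u|circle_measure. cmod (d k u)))"
      using id by (simp add: nn_integral_eq_integral)
    also have "\<dots> \<le> (\<Sum>k. ennreal (2 * pi * (1/2)^k))"
      by (intro suminf_le ennreal_leI d1) auto
    also have "\<dots> < \<infinity>"
      by (subst suminf_ennreal2) (auto intro!: summable_mult summable_geometric)
    finally have "(\<integral>\<^sup>+u. (\<Sum>k. ennreal (cmod (d k u))) \<partial>circle_measure) \<noteq> \<infinity>" by simp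
    then have "AE u in circle_measure. (\<Sum>k. ennreal (cmod (d k u))) \<noteq> \<infinity>"
      by (rule nn_integral_noteq_infinite[rotated]) (use id in measurable)
    then show ?thesis
      by (rule eventually_mono) (auto intro: summable_suminf_not_top)
  qed
  define g where "g u = lim (\<lambda>k. ?S (r k) u)" for u
  have mS: "?S N \<in> borel_measurable circle_measure" for N
    by (rule square_integrable_measurable[OF trig_sum_square_integrable])
  have mg: "g \<in> borel_measurable circle_measure"
    unfolding g_def by (intro borel_measurable_lim_metric mS)
  have conv: "AE u in circle_measure. (\<lambda>k. ?S (r k) u) \<longlonglongrightarrow> g u"
    using \<open>AE u in circle_measure. summable (\<lambda>k. cmod (d k u))\<close>
  proof eventually_elim
    case (elim u)
    then have "summable (\<lambda>k. d k u)" by (rule summable_norm_cancel)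
    then have "convergent (\<lambda>n. \<Sum>k<n. d k u)" by (simp add: summable_iff_convergent)
    then have "convergent (\<lambda>n. ?S (r 0) u + (\<Sum>k<n. d k u))"
      by (intro convergent_add convergent_const)
    moreover have "?S (r 0) u + (\<Sum>k<n. d k u) = ?S (r n) u" for n
      unfolding d_def by (simp add: sum_lessThan_telescope[of "\<lambda>k. ?S (r k) u"])
    ultimately show ?case by (simp add: g_def convergent_LIMSEQ_iff)
  qed
  have bound: "(\<integral>\<^sup>+u. ennreal ((cmod (g u - ?S M u))\<^sup>2) \<partial>circle_measure) \<le> ennreal (2 * pi * (L - A M))" for M
  proof -
    have "(\<integral>\<^sup>+u. ennreal ((cmod (g u - ?S M u))\<^sup>2) \<partial>circle_measure)
       = (\<integral>\<^sup>+u. liminf (\<lambda>k. ennreal ((cmod (?S (r k) u - ?S M u))\<^sup>2)) \<partial>circle_measure)"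
    proof (rule nn_integral_cong_AE, use conv in eventually_elim)
      case (elim u)
      then have "(\<lambda>k. ennreal ((cmod (?S (r k) u - ?S M u))\<^sup>2)) \<longlonglongrightarrow> ennreal ((cmod (g u - ?S M u))\<^sup>2)"
        by (intro tendsto_intros)
      from lim_imp_Liminf[OF sequentially_bot this] show ?case by (rule sym)
    qed
    also have "\<dots> \<le> liminf (\<lambda>k. \<integral>\<^sup>+u. ennreal ((cmod (?S (r k) u - ?S M u))\<^sup>2) \<partial>circle_measure)"
      by (intro nn_integral_liminf) (use mS in measurable)
    also have "\<dots> \<le> liminf (\<lambda>k::nat. ennreal (2 * pi * (L - A M)))"
    proof (rule Liminf_mono)
      show "eventually (\<lambda>k. (\<integral>\<^sup>+u. ennreal ((cmod (?S (r k) u - ?S M u))\<^sup>2) \<partial>circle_measure)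
          \<le> ennreal (2 * pi * (L - A M))) sequentially"
        using eventually_ge_at_top[of M]
      proof eventually_elim
        case (elim k)
        then have "M \<le> r k" using r(2)[of k] by linarith
        have "(\<integral>\<^sup>+u. ennreal ((cmod (?S (r k) u - ?S M u))\<^sup>2) \<partial>circle_measure)
           = ennreal (LINT u|circle_measure. (cmod (?S (r k) u - ?S M u))\<^sup>2)"
          by (intro nn_integral_eq_integral square_integrable_norm_sq square_integrable_diff trig_sum_square_integrable) auto
        then show ?case using dist[OF \<open>M \<le> r k\<close>] by (simp add: ennreal_leI)
      qed
    qed
    also have "\<dots> = ennreal (2 * pi * (L - A M))" by (simp add: Liminf_const)
    finally show ?thesis .
  qed
  have gS: "square_integrable (\<lambda>u. g u - ?S M u)" for M
    unfolding square_integrable_def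
  proof
    show m: "(\<lambda>u. g u - ?S M u) \<in> borel_measurable circle_measure" using mg mS by auto
    show "integrable circle_measure (\<lambda>u. (cmod (g u - ?S M u))\<^sup>2)"
      by (rule integrableI_bounded)
        (use m bound[of M] le_less_trans[OF bound[of M] ennreal_less_top] in auto)
  qed
  have "square_integrable (\<lambda>u. (g u - ?S 0 u) + ?S 0 u)"
    by (intro square_integrable_add gS trig_sum_square_integrable)
  then have g: "square_integrable g" by simp
  show thesis
  proof
    have "g (u + 2 * pi) = g u" for u
      by (simp add: g_def trig_sum_def mode_periodic)
    then show "g \<in> L2_circle" using g by (simp add: L2_circle_def square_integrable_def)
    have up: "(LINT u|circle_measure. (cmod (g u - ?S M u))\<^sup>2) \<le> 2 * pi * (L - A M)" for M
    proof -
      have "ennreal (LINT u|circle_measure. (cmod (g u - ?S M u))\<^sup>2) \<le> ennreal (2 * pi * (L - A M))"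
        using bound[of M] nn_integral_eq_integral[OF square_integrable_norm_sq[OF gS[of M]]] by simp
      then show ?thesis using L(2)[of M] by (simp add: ennreal_le_iff)
    qed
    show "(\<lambda>N. LINT u|circle_measure. (cmod (g u - ?S N u))\<^sup>2) \<longlonglongrightarrow> 0"
    proof (rule tendsto_sandwich[OF _ _ tendsto_const])
      show "(\<lambda>M. 2 * pi * (L - A M)) \<longlonglongrightarrow> 0"
        by (rule tendsto_eq_intros L refl | simp)+
    qed (use up in auto)
  qed
qed

text \<open>
  The limit provided by the Riesz-Fischer theorem has the same coefficients as \<open>f\<close>, hence agrees with
  \<open>f\<close> almost everywhere.
\<close>

theorem fourier_series_L2_converges:
  assumes f: "square_integrable f"
  shows "(\<lambda>N. LINT u|circle_measure. (cmod (f u - trig_sum (fourier_coeff f) N u))\<^sup>2) \<longlonglongrightarrow> 0"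
proof -
  obtain g where g: "g \<in> L2_circle"
      and lim: "(\<lambda>N. LINT u|circle_measure. (cmod (g u - trig_sum (fourier_coeff f) N u))\<^sup>2) \<longlonglongrightarrow> 0"
    using Riesz_Fischer[OF Bessel_summable[OF f]] by blast
  have sg: "square_integrable g" using g by (simp add: L2_circle_def square_integrable_def)
  have "AE u in circle_measure. f u = g u"
    by (rule fourier_coeff_unique) (simp_all add: f sg square_integrable_integrable fourier_coeff_L2_limit[OF sg lim])
  then have "(LINT u|circle_measure. (cmod (f u - trig_sum (fourier_coeff f) N u))\<^sup>2)
      = (LINT u|circle_measure. (cmod (g u - trig_sum (fourier_coeff f) N u))\<^sup>2)" for N
    using f sg trig_sum_square_integrable[of "fourier_coeff f" N]
    by (intro integral_cong_AE) (auto elim!: eventually_mono simp: square_integrable_def)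
  then show ?thesis using lim by simp
qed

text \<open>
  The convolution is written as a limit of symmetric partial sums, which is exactly what \<open>L\<^sup>2\<close>
  convergence of the series of \<open>f\<close> provides.
\<close>

theorem fourier_coeff_mult:
  assumes f: "square_integrable f" and g: "square_integrable g"
  shows "(\<lambda>N. \<Sum>k\<in>{- int N..int N}. fourier_coeff f k * fourier_coeff g (n - k))
    \<longlonglongrightarrow> fourier_coeff (\<lambda>u. f u * g u) n"
proof -
  let ?S = "trig_sum (fourier_coeff f)"
  have gn: "square_integrable (\<lambda>u. mode (- n) u * g u)"
    by (rule square_integrable_bounded_mult[OF g, where B=1]) auto
  have "(\<lambda>N. (LINT u|circle_measure. ?S N u * (mode (- n) u * g u)) / (2 * of_real pi))
      \<longlonglongrightarrow> (LINT u|circle_measure. f u * (mode (- n) u * g u)) / (2 * of_real pi)"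
    by (intro tendsto_divide L2_limit_mult[OF trig_sum_square_integrable f gn fourier_series_L2_converges[OF f]]) auto
  moreover have "(LINT u|circle_measure. f u * (mode (- n) u * g u)) / (2 * of_real pi) = fourier_coeff (\<lambda>u. f u * g u) n"
    by (simp add: fourier_coeff_eq mult_ac)
  moreover have "(LINT u|circle_measure. ?S N u * (mode (- n) u * g u)) / (2 * of_real pi)
      = (\<Sum>k\<in>{- int N..int N}. fourier_coeff f k * fourier_coeff g (n - k))" for N
  proof -
    have i: "integrable circle_measure (\<lambda>u. g u * mode m u)" for m
      by (intro integrable_mult_mode square_integrable_integrable g)
    have "(LINT u|circle_measure. ?S N u * (mode (- n) u * g u))
        = (LINT u|circle_measure. (\<Sum>k\<in>{- int N..int N}. fourier_coeff f k * (g u * mode (k - n) u)))"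
    proof (intro Bochner_Integration.integral_cong refl)
      fix u
      show "?S N u * (mode (- n) u * g u) = (\<Sum>k\<in>{- int N..int N}. fourier_coeff f k * (g u * mode (k - n) u))"
        unfolding trig_sum_def sum_distrib_right
      proof (intro sum.cong refl)
        fix k
        have "fourier_coeff f k * mode k u * (mode (- n) u * g u) = fourier_coeff f k * (g u * (mode k u * mode (- n) u))"
          by (simp only: mult_ac)
        then show "fourier_coeff f k * mode k u * (mode (- n) u * g u) = fourier_coeff f k * (g u * mode (k - n) u)"
          by (simp only: mode_mult_mode) simp
      qed
    qed
    also have "\<dots> = (\<Sum>k\<in>{- int N..int N}. LINT u|circle_measure. fourier_coeff f k * (g u * mode (k - n) u))"
      by (intro Bochner_Integration.integral_sum integrable_mult_right i)
    also have "\<dots> = (\<Sum>k\<in>{- int N..int N}. fourier_coeff f k * (2 * of_real pi * fourier_coeff g (n - k)))"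
      by (simp add: fourier_coeff_eq[of g])
    also have "\<dots> = (\<Sum>k\<in>{- int N..int N}. fourier_coeff f k * fourier_coeff g (n - k)) * (2 * of_real pi)"
      unfolding sum_distrib_right by (intro sum.cong refl) simp
    finally show ?thesis by simp
  qed
  ultimately show ?thesis by (simp only:)
qed

section \<open>Abel sums near the boundary of the disc\<close>

lemma fourier_coeff_bound:
  assumes "integrable circle_measure f"
  shows "cmod (fourier_coeff f n) \<le> (LINT u|circle_measure. cmod (f u)) / (2 * pi)"
proof -
  have "cmod (LINT u|circle_measure. f u * mode (- n) u) \<le> (LINT u|circle_measure. cmod (f u * mode (- n) u))"
    by (rule integral_norm_bound)
  then show ?thesis by (simp add: fourier_coeff_eq norm_divide norm_mult divide_right_mono)
qed

text \<open>
  The sum and the integral can be interchanged by dominated convergence; the integrand on the right is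
  \<open>f\<close> against the kernel whose Fourier series has the weights \<open>a n\<close>.
\<close>

lemma fourier_coeff_weighted_sums:
  fixes a :: "nat \<Rightarrow> complex" and m :: "nat \<Rightarrow> int"
  assumes f: "integrable circle_measure f" and a: "summable (\<lambda>n. cmod (a n))"
  shows "(\<lambda>n. a n * fourier_coeff f (m n)) sums
    ((LINT u|circle_measure. f u * (\<Sum>n. a n * mode (- m n) u)) / (2 * of_real pi))"
    and "integrable circle_measure (\<lambda>u. f u * (\<Sum>n. a n * mode (- m n) u))"
proof -
  let ?g = "\<lambda>n u. a n * (f u * mode (- m n) u)"
  have sm: "summable (\<lambda>n. a n * mode (- m n) u)" for u
    by (rule summable_norm_cancel) (simp add: norm_mult a)
  have 1: "integrable circle_measure (?g n)" for n
    using integrable_mult_mode[OF f, of "- m n"] by simp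
  have 2: "AE u in circle_measure. summable (\<lambda>n. norm (?g n u))"
    using a by (simp add: norm_mult summable_mult2)
  have 3: "summable (\<lambda>n. LINT u|circle_measure. norm (?g n u))"
    using a by (simp add: norm_mult summable_mult2)
  have eq: "(\<Sum>n. ?g n u) = f u * (\<Sum>n. a n * mode (- m n) u)" for u
    using suminf_mult[OF sm[of u], of "f u"] by (simp add: mult_ac)
  have "(\<lambda>n. integral\<^sup>L circle_measure (?g n)) sums (LINT u|circle_measure. (\<Sum>n. ?g n u))"
    by (rule sums_integral[OF 1 2 3])
  from sums_divide[OF this, of "2 * of_real pi"]
  show "(\<lambda>n. a n * fourier_coeff f (m n)) sums
    ((LINT u|circle_measure. f u * (\<Sum>n. a n * mode (- m n) u)) / (2 * of_real pi))"
    by (simp add: eq fourier_coeff_eq)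
  show "integrable circle_measure (\<lambda>u. f u * (\<Sum>n. a n * mode (- m n) u))"
    using integrable_suminf[OF 1 2 3] by (simp add: eq)
qed

lemma mode_of_nat: "mode (int n) u = mode 1 u ^ n" "mode (- int n) u = mode (- 1) u ^ n"
  using Complex.DeMoivre[of u n] Complex.DeMoivre[of "- u" n] by (simp_all add: mode_def mult.commute)

text \<open>
  The squared distance from the boundary point \<open>cis u\<close> to the point \<open>r\<close> of the disc.
\<close>

definition chord_sq :: "real \<Rightarrow> real \<Rightarrow> real" where
  "chord_sq r u = (cmod (1 - of_real r * mode (- 1) u))\<^sup>2"

text \<open>
  Any quadratic lower bound valid up to \<open>\<bar>u\<bar> = pi\<close> will do; this one follows from
  \<open>x cos x \<le> sin x\<close> at \<open>x = u/4\<close> and two applications of the double-angle formulas.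
\<close>

lemma one_minus_cos_ge:
  fixes u :: real
  assumes "\<bar>u\<bar> \<le> pi"
  shows "u\<^sup>2 / 8 \<le> 1 - cos u"
proof -
  have *: "x / 4 \<le> sin (x / 2)" if x: "0 \<le> x" "x \<le> pi" for x :: real
  proof (cases "x = 0")
    case False
    have "\<exists>z>0. z < x / 4 \<and> sin (x / 4) - sin 0 = (x / 4 - 0) * cos z"
      using False x by (intro MVT2) auto
    then obtain z where z: "0 < z" "z < x / 4" "sin (x / 4) = (x / 4) * cos z" by auto
    have "cos (x / 4) \<le> cos z"
      using z x by (intro cos_monotone_0_pi_le) auto
    then have s: "(x / 4) * cos (x / 4) \<le> sin (x / 4)"
      unfolding z(3) using x by (intro mult_left_mono) auto
    have c0: "0 \<le> cos (x / 4)" using x by (intro cos_ge_zero) auto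
    have c2: "1 / 2 \<le> (cos (x / 4))\<^sup>2"
    proof -
      have "cos (x / 2) = 2 * (cos (x / 4))\<^sup>2 - 1"
        using cos_double_cos[of "x / 4"] by simp
      moreover have "0 \<le> cos (x / 2)" using x by (intro cos_ge_zero) auto
      ultimately show ?thesis by simp
    qed
    have "x / 4 \<le> 2 * ((x / 4) * (cos (x / 4))\<^sup>2)"
      using mult_left_mono[OF c2, of "x / 2"] x by simp
    also have "\<dots> = 2 * ((x / 4) * cos (x / 4)) * cos (x / 4)" by (simp add: power2_eq_square)
    also have "\<dots> \<le> 2 * sin (x / 4) * cos (x / 4)"
      using s c0 by (intro mult_right_mono) auto
    also have "\<dots> = sin (x / 2)" using sin_double[of "x / 4"] by simp
    finally show ?thesis .
  qed simp
  have "(\<bar>u\<bar> / 4)\<^sup>2 \<le> (sin (\<bar>u\<bar> / 2))\<^sup>2"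
    using *[of "\<bar>u\<bar>"] assms by (intro power_mono) auto
  moreover have "cos \<bar>u\<bar> = 1 - 2 * (sin (\<bar>u\<bar> / 2))\<^sup>2"
    using cos_double_sin[of "\<bar>u\<bar> / 2"] by simp
  ultimately show ?thesis by (simp add: power_divide)
qed

lemma chord_sq_ge:
  assumes "1 / 2 \<le> r" "\<bar>u\<bar> \<le> pi"
  shows "((1 - r)\<^sup>2 + u\<^sup>2) / 8 \<le> chord_sq r u"
proof -
  have "chord_sq r u = (1 - r * cos u)\<^sup>2 + (r * sin u)\<^sup>2"
    by (simp add: chord_sq_def mode_def cmod_power2)
  also have "\<dots> = 1 - 2 * r * cos u + r\<^sup>2 * ((cos u)\<^sup>2 + (sin u)\<^sup>2)"
    by algebra
  also have "\<dots> = 1 - 2 * r * cos u + r\<^sup>2" by simp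
  also have "\<dots> = (1 - r)\<^sup>2 + 2 * r * (1 - cos u)"
    by (simp add: power2_eq_square algebra_simps)
  finally have eq: "chord_sq r u = (1 - r)\<^sup>2 + 2 * r * (1 - cos u)" .
  have "u\<^sup>2 / 8 \<le> 1 * (1 - cos u)" using one_minus_cos_ge[OF assms(2)] by simp
  also have "\<dots> \<le> 2 * r * (1 - cos u)"
    using assms by (intro mult_right_mono) auto
  finally have "u\<^sup>2 / 8 \<le> 2 * r * (1 - cos u)" .
  moreover have "(1 - r)\<^sup>2 / 8 \<le> (1 - r)\<^sup>2" by simp
  ultimately show ?thesis unfolding eq add_divide_distrib by (rule add_mono[rotated])
qed

text \<open>
  Since \<open>(1 - r)\<^sup>2 + u\<^sup>2\<close> dominates every product \<open>(1 - r) powr t * \<bar>u\<bar> powr (2 - t)\<close> with \<open>0 \<le> t \<le> 2\<close>,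
  powers of \<open>\<bar>u\<bar>\<close> can be traded for powers of \<open>1 - r\<close>. The choice \<open>t = 1 - s + e\<close> leaves
  \<open>\<bar>u\<bar> powr (e - 1)\<close>, which is just integrable; the loss \<open>(1 - r) powr (-e)\<close> can be made as small as
  desired.
\<close>

lemma kernel_power_bound:
  assumes r: "1 / 2 \<le> r" "r < 1" and u: "u \<noteq> 0" "\<bar>u\<bar> \<le> pi" and s: "0 < e" "e \<le> s" "s \<le> 1"
  shows "\<bar>u\<bar> powr s / chord_sq r u \<le> 8 * (1 - r) powr (s - 1 - e) * \<bar>u\<bar> powr (e - 1)"
proof -
  define d where "d = 1 - r"
  define t where "t = 1 - s + e"
  have d: "d > 0" using r by (simp add: d_def)
  have t: "0 \<le> t" "t \<le> 2" using s by (auto simp: t_def)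
  have "d powr t * \<bar>u\<bar> powr (2 - t) \<le> d\<^sup>2 + u\<^sup>2"
  proof (cases "d \<le> \<bar>u\<bar>")
    case True
    then have "d powr t * \<bar>u\<bar> powr (2 - t) \<le> \<bar>u\<bar> powr t * \<bar>u\<bar> powr (2 - t)"
      using d t by (intro mult_right_mono powr_mono2) auto
    also have "\<dots> = u\<^sup>2" using u by (simp add: powr_add[symmetric])
    finally show ?thesis by (simp add: add_increasing)
  next
    case False
    then have "d powr t * \<bar>u\<bar> powr (2 - t) \<le> d powr t * d powr (2 - t)"
      using d t by (intro mult_left_mono powr_mono2) auto
    also have "\<dots> = d\<^sup>2" using d by (simp add: powr_add[symmetric])
    finally show ?thesis by (simp add: add_increasing2)
  qed
  also have "\<dots> \<le> 8 * chord_sq r u" using chord_sq_ge[OF r(1) u(2)] by (simp add: d_def)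
  finally have lb: "d powr t * \<bar>u\<bar> powr (2 - t) / 8 \<le> chord_sq r u" by simp
  have pos: "0 < d powr t * \<bar>u\<bar> powr (2 - t) / 8" using d u by simp
  have "\<bar>u\<bar> powr s / chord_sq r u \<le> \<bar>u\<bar> powr s / (d powr t * \<bar>u\<bar> powr (2 - t) / 8)"
    using lb pos by (intro divide_left_mono) auto
  also have "\<dots> = 8 * d powr (- t) * (\<bar>u\<bar> powr s * inverse (\<bar>u\<bar> powr (2 - t)))"
    by (simp add: powr_minus field_simps)
  also have "inverse (\<bar>u\<bar> powr (2 - t)) = \<bar>u\<bar> powr (- (2 - t))"
    by (simp only: powr_minus)
  also have "\<bar>u\<bar> powr s * \<bar>u\<bar> powr (- (2 - t)) = \<bar>u\<bar> powr (e - 1)"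
    by (simp add: powr_add[symmetric] t_def)
  also have "- t = s - 1 - e" by (simp add: t_def)
  finally show ?thesis by (simp add: d_def)
qed

lemma integrable_abs_powr:
  assumes "-1 < a"
  shows "integrable circle_measure (\<lambda>u. \<bar>u\<bar> powr a)"
proof -
  have p: "(\<lambda>u. \<bar>u\<bar> powr a) integrable_on {0..pi}"
    by (rule integrable_eq[OF has_integral_integrable[OF has_integral_powr_from_0[OF assms]]]) auto
  then have m: "(\<lambda>u. \<bar>u\<bar> powr a) integrable_on {-pi..0}"
    using Henstock_Kurzweil_Integration.integrable_reflect_real[where f="\<lambda>u. \<bar>u\<bar> powr a" and a=0 and b=pi, THEN iffD2]
    by simp
  have "(\<lambda>u. \<bar>u\<bar> powr a) integrable_on {-pi..pi}"
    by (rule Henstock_Kurzweil_Integration.integrable_combine[OF _ _ m p]) auto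
  then have "(\<lambda>u. \<bar>u\<bar> powr a) absolutely_integrable_on {-pi..pi}"
    by (rule nonnegative_absolutely_integrable_1) simp
  then show ?thesis
    by (simp add: set_integrable_def integrable_restrict_space)
qed

lemma kernel_integral_bound:
  assumes F: "F \<in> borel_measurable circle_measure" "AE u in circle_measure. cmod (F u) \<le> C * \<bar>u\<bar> powr s"
    and r: "1 / 2 \<le> r" "r < 1" and s: "0 < e" "e \<le> s" "s \<le> 1" and C: "0 \<le> C"
    and H: "H \<in> borel_measurable circle_measure"
      "\<And>u. cmod (H u) \<le> B / chord_sq r u" and B: "0 \<le> B"
  shows "cmod (LINT u|circle_measure. F u * H u)
    \<le> C * B * (8 * (LINT u|circle_measure. \<bar>u\<bar> powr (e - 1))) * (1 - r) powr (s - 1 - e)"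
proof -
  define k where "k = C * B * 8 * (1 - r) powr (s - 1 - e)"
  have i: "integrable circle_measure (\<lambda>u. k * \<bar>u\<bar> powr (e - 1))"
    using integrable_abs_powr[of "e - 1"] s by simp
  have ae: "AE u in circle_measure. cmod (F u * H u) \<le> k * \<bar>u\<bar> powr (e - 1)"
    using AE_circle_neq[of 0] F(2)
  proof eventually_elim
    case (elim u)
    have "cmod (F u * H u) \<le> (C * \<bar>u\<bar> powr s) * (B / chord_sq r u)"
      unfolding norm_mult using elim H(2)[of u] C by (intro mult_mono) auto
    also have "\<dots> = C * B * (\<bar>u\<bar> powr s / chord_sq r u)" by simp
    also have "\<dots> \<le> C * B * (8 * (1 - r) powr (s - 1 - e) * \<bar>u\<bar> powr (e - 1))"
      using elim C B r s by (intro mult_left_mono kernel_power_bound) auto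
    finally show ?case by (simp add: k_def mult_ac)
  qed
  have "cmod (LINT u|circle_measure. F u * H u) \<le> (LINT u|circle_measure. k * \<bar>u\<bar> powr (e - 1))"
  proof (rule order_trans[OF integral_norm_bound])
    have "integrable circle_measure (\<lambda>u. F u * H u)"
    proof (rule Bochner_Integration.integrable_bound[OF i])
      show "(\<lambda>u. F u * H u) \<in> borel_measurable circle_measure" using F H by auto
      show "AE u in circle_measure. norm (F u * H u) \<le> norm (k * \<bar>u\<bar> powr (e - 1))"
        using ae by eventually_elim simp
    qed
    then show "(LINT u|circle_measure. cmod (F u * H u)) \<le> (LINT u|circle_measure. k * \<bar>u\<bar> powr (e - 1))"
      using i ae by (intro integral_mono_AE) auto
  qed
  then show ?thesis by (simp add: k_def mult_ac)
qed

text \<open>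
  Since the negative coefficients vanish, the Cauchy kernel may be completed to the Poisson kernel
  \<open>(1 - r\<^sup>2) / chord_sq r u\<close>. Its numerator supplies the additional factor \<open>1 - r\<close> that makes the Abel
  sum decay.
\<close>

lemma poisson_bound:
  assumes F: "integrable circle_measure F" "AE u in circle_measure. cmod (F u) \<le> C * \<bar>u\<bar> powr s"
    and neg: "\<And>n. n < 0 \<Longrightarrow> fourier_coeff F n = 0"
    and r: "1 / 2 \<le> r" "r < 1" and s: "0 < e" "e \<le> s" "s \<le> 1" and C: "0 \<le> C"
  shows "cmod (\<Sum>n. of_real r ^ n * fourier_coeff F (int n))
    \<le> 16 * C * (LINT u|circle_measure. \<bar>u\<bar> powr (e - 1)) * (1 - r) powr (s - e)"
proof -
  define q where "q u = of_real r * mode (- 1) u" for u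
  have q: "cmod (q u) < 1" for u using r by (simp add: q_def norm_mult)
  have ne: "of_real r * mode (- 1) u \<noteq> 1" for u
    using q[of u] by (auto simp: q_def)
  have sr: "summable (\<lambda>n. cmod (of_real r ^ n))" "summable (\<lambda>n. cmod (of_real r ^ Suc n))"
    using r by (auto simp: norm_power norm_mult intro: summable_geometric summable_mult)
  have pow: "(\<Sum>n. of_real r ^ n * mode (- int n) u) = 1 / (1 - q u)" for u
  proof -
    have "of_real r ^ n * mode (- int n) u = q u ^ n" for n
      by (simp add: q_def mode_of_nat power_mult_distrib)
    then show ?thesis using suminf_geometric[OF q[of u]] by simp
  qed
  have pow': "(\<Sum>n. of_real r ^ Suc n * mode (- (- int (Suc n))) u) = cnj (q u) / (1 - cnj (q u))" for u
  proof -
    have "of_real r ^ Suc n * mode (- (- int (Suc n))) u = cnj (q u) * cnj (q u) ^ n" for n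
      using mode_of_nat(1)[of "Suc n" u]
      by (simp add: q_def cnj_mode power_mult_distrib del: of_nat_Suc)
    then show ?thesis using suminf_geometric[of "cnj (q u)"] suminf_mult[OF summable_geometric, of "cnj (q u)" "cnj (q u)"] q[of u] by simp
  qed
  note s1 = fourier_coeff_weighted_sums[OF F(1) sr(1), of int, unfolded pow]
  note s2 = fourier_coeff_weighted_sums[OF F(1) sr(2), of "\<lambda>n. - int (Suc n)", unfolded pow']
  have z: "(LINT u|circle_measure. F u * (cnj (q u) / (1 - cnj (q u)))) = 0"
  proof -
    have "(\<lambda>n. of_real r ^ Suc n * fourier_coeff F (- int (Suc n))) sums 0"
      by (simp add: neg del: of_nat_Suc)
    from sums_unique2[OF this s2(1)] show ?thesis by simp
  qed
  define H where "H u = complex_of_real ((1 - r\<^sup>2) / chord_sq r u)" for u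
  have H: "1 / (1 - q u) + cnj (q u) / (1 - cnj (q u)) = H u" for u
  proof -
    have ne: "1 - q u \<noteq> 0" using q[of u] by auto
    have nc: "1 - cnj (q u) \<noteq> 0" using q[of u] by (metis complex_mod_cnj eq_iff_diff_eq_0 norm_one less_irrefl)
    have m: "(1 - q u) * (1 - cnj (q u)) = of_real (chord_sq r u)"
      using complex_norm_square[of "1 - q u"] by (simp add: chord_sq_def q_def)
    have "1 / (1 - q u) + cnj (q u) / (1 - cnj (q u)) = (1 - q u * cnj (q u)) / ((1 - q u) * (1 - cnj (q u)))"
      using ne nc by (simp add: field_simps)
    also have "q u * cnj (q u) = of_real (r\<^sup>2)"
      by (simp add: q_def cnj_mode mode_mult_mode power2_eq_square mult_ac flip: mult.assoc)
    finally show ?thesis unfolding m by (simp add: H_def)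
  qed
  have "(LINT u|circle_measure. F u * H u) = (LINT u|circle_measure. F u * (1 / (1 - q u)) + F u * (cnj (q u) / (1 - cnj (q u))))"
    by (simp only: H[symmetric] distrib_left)
  also have "\<dots> = (LINT u|circle_measure. F u * (1 / (1 - q u)))"
    using s1(2) s2(2) z by (simp add: Bochner_Integration.integral_add)
  finally have sum: "(\<Sum>n. of_real r ^ n * fourier_coeff F (int n)) = (LINT u|circle_measure. F u * H u) / (2 * of_real pi)"
    using sums_unique[OF s1(1)] by simp
  have cH: "continuous_on {-pi..pi} H"
    unfolding H_def chord_sq_def
    by (intro continuous_intros) (use ne in auto)
  have "cmod (LINT u|circle_measure. F u * H u)
    \<le> C * (2 * (1 - r)) * (8 * (LINT u|circle_measure. \<bar>u\<bar> powr (e - 1))) * (1 - r) powr (s - 1 - e)"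
  proof (rule kernel_integral_bound[OF _ F(2) r s C])
    show "F \<in> borel_measurable circle_measure" using F(1) by auto
    show "H \<in> borel_measurable circle_measure"
      by (rule continuous_imp_measurable_circle[OF cH])
    have "1 - r\<^sup>2 \<le> 2 * (1 - r)" using zero_le_power2[of "1 - r"] by (simp add: power2_eq_square algebra_simps)
    moreover have "0 \<le> 1 - r\<^sup>2" using r by (simp add: power_le_one)
    ultimately show "cmod (H u) \<le> 2 * (1 - r) / chord_sq r u" for u
      by (simp add: H_def chord_sq_def norm_divide divide_right_mono del: of_real_diff of_real_power)
  qed (use r in auto)
  also have "\<dots> = 16 * C * (LINT u|circle_measure. \<bar>u\<bar> powr (e - 1)) * ((1 - r) powr 1 * (1 - r) powr (s - 1 - e))"
    using r by simp
  also have "(1 - r) powr 1 * (1 - r) powr (s - 1 - e) = (1 - r) powr (s - e)"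
    unfolding powr_add[symmetric] by simp
  finally have b: "cmod (LINT u|circle_measure. F u * H u) \<le> 16 * C * (LINT u|circle_measure. \<bar>u\<bar> powr (e - 1)) * (1 - r) powr (s - e)" .
  have "cmod (\<Sum>n. of_real r ^ n * fourier_coeff F (int n)) = cmod (LINT u|circle_measure. F u * H u) / (2 * pi)"
    by (simp add: sum norm_divide norm_mult)
  also have "\<dots> \<le> cmod (LINT u|circle_measure. F u * H u)"
    using pi_ge_two by (intro divide_le_eq_1_pos[THEN iffD2] mult_imp_div_pos_le) (auto simp: mult_le_cancel_left1)
  finally show ?thesis using b by linarith
qed

text \<open>
  The Abel sum is \<open>F\<close> integrated against \<open>q / (1 - q)\<^sup>2\<close> with \<open>q = r cis (-u)\<close>, the derivative of
  the geometric series, whose modulus is at most \<open>1 / chord_sq r u\<close>.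
\<close>

lemma derivative_kernel_bound:
  assumes F: "integrable circle_measure F" "AE u in circle_measure. cmod (F u) \<le> C * \<bar>u\<bar> powr s"
    and r: "1 / 2 \<le> r" "r < 1" and s: "0 < e" "e \<le> s" "s \<le> 1" and C: "0 \<le> C"
  shows "cmod (\<Sum>n. of_nat (Suc n) * of_real r ^ Suc n * fourier_coeff F (int (Suc n)))
    \<le> 8 * C * (LINT u|circle_measure. \<bar>u\<bar> powr (e - 1)) * (1 - r) powr (s - 1 - e)"
proof -
  define q where "q u = of_real r * mode (- 1) u" for u
  have q: "cmod (q u) < 1" for u using r by (simp add: q_def norm_mult)
  have ne: "of_real r * mode (- 1) u \<noteq> 1" for u
    using q[of u] by (auto simp: q_def)
  have sr: "summable (\<lambda>n. cmod (of_nat (Suc n) * of_real r ^ Suc n))"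
  proof -
    have "summable (\<lambda>n. r * (of_nat (Suc n) * r ^ n))"
      using geometric_deriv_sums[of r] r by (intro summable_mult) (auto simp: summable_def)
    then show ?thesis using r by (simp add: norm_mult norm_power mult_ac del: of_nat_Suc)
  qed
  define H where "H u = q u / (1 - q u)\<^sup>2" for u
  have pow: "(\<Sum>n. of_nat (Suc n) * of_real r ^ Suc n * mode (- int (Suc n)) u) = H u" for u
  proof -
    have t: "of_nat (Suc n) * of_real r ^ Suc n * mode (- int (Suc n)) u = q u * (of_nat (Suc n) * q u ^ n)" for n
      using mode_of_nat(2)[of "Suc n" u] by (simp add: q_def power_mult_distrib mult_ac del: of_nat_Suc)
    show ?thesis
      unfolding t using sums_unique[OF sums_mult[OF geometric_deriv_sums[OF q[of u]], of "q u"]]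
      by (simp add: H_def del: of_nat_Suc)
  qed
  note s1 = fourier_coeff_weighted_sums[OF F(1) sr, of "\<lambda>n. int (Suc n)", unfolded pow]
  have cH: "continuous_on {-pi..pi} H"
    unfolding H_def q_def
    by (intro continuous_intros) (use ne in auto)
  have "cmod (LINT u|circle_measure. F u * H u)
    \<le> C * 1 * (8 * (LINT u|circle_measure. \<bar>u\<bar> powr (e - 1))) * (1 - r) powr (s - 1 - e)"
  proof (rule kernel_integral_bound[OF _ F(2) r s C])
    show "F \<in> borel_measurable circle_measure" using F(1) by auto
    show "H \<in> borel_measurable circle_measure"
      by (rule continuous_imp_measurable_circle[OF cH])
    show "cmod (H u) \<le> 1 / chord_sq r u" for u
      using q[of u] by (simp add: H_def chord_sq_def norm_divide norm_power divide_right_mono flip: q_def)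
  qed auto
  moreover have "cmod (\<Sum>n. of_nat (Suc n) * of_real r ^ Suc n * fourier_coeff F (int (Suc n)))
      = cmod (LINT u|circle_measure. F u * H u) / (2 * pi)"
    unfolding sums_unique[OF s1(1), symmetric] by (simp add: norm_divide norm_mult)
  moreover have "cmod (LINT u|circle_measure. F u * H u) / (2 * pi) \<le> cmod (LINT u|circle_measure. F u * H u)"
    using pi_ge_two by (intro mult_imp_div_pos_le) (auto simp: mult_le_cancel_left1)
  ultimately show ?thesis by simp
qed

section \<open>Fourier coefficients of products, multipliers and derivatives\<close>

lemma L2_circle_square_integrable: "f \<in> L2_circle \<Longrightarrow> square_integrable f"
  by (simp add: L2_circle_def square_integrable_def)

text \<open>
  The Leibniz rule for functions whose derivatives are known only through their Fourier coefficients: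
  \<open>k + (n - k) = n\<close> inside the convolution.
\<close>

lemma fourier_coeff_Leibniz:
  assumes f: "square_integrable f" "square_integrable f'" and g: "square_integrable g" "square_integrable g'"
    and f': "\<And>n. fourier_coeff f' n = \<i> * of_int n * fourier_coeff f n"
    and g': "\<And>n. fourier_coeff g' n = \<i> * of_int n * fourier_coeff g n"
  shows "fourier_coeff (\<lambda>u. f' u * g u) n + fourier_coeff (\<lambda>u. f u * g' u) n
    = \<i> * of_int n * fourier_coeff (\<lambda>u. f u * g u) n"
proof -
  have eq: "fourier_coeff f' k * fourier_coeff g (n - k) + fourier_coeff f k * fourier_coeff g' (n - k)
      = \<i> * of_int n * (fourier_coeff f k * fourier_coeff g (n - k))" for k
    unfolding f' g' by (simp add: algebra_simps)
  have "(\<lambda>N. (\<Sum>k\<in>{- int N..int N}. fourier_coeff f' k * fourier_coeff g (n - k))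
        + (\<Sum>k\<in>{- int N..int N}. fourier_coeff f k * fourier_coeff g' (n - k)))
     \<longlonglongrightarrow> fourier_coeff (\<lambda>u. f' u * g u) n + fourier_coeff (\<lambda>u. f u * g' u) n"
    by (rule tendsto_add[OF fourier_coeff_mult[OF f(2) g(1)] fourier_coeff_mult[OF f(1) g(2)]])
  moreover have "(\<lambda>N. \<i> * of_int n * (\<Sum>k\<in>{- int N..int N}. fourier_coeff f k * fourier_coeff g (n - k)))
     \<longlonglongrightarrow> \<i> * of_int n * fourier_coeff (\<lambda>u. f u * g u) n"
    by (rule tendsto_mult[OF tendsto_const fourier_coeff_mult[OF f(1) g(1)]])
  ultimately show ?thesis
    unfolding sum.distrib[symmetric] eq sum_distrib_left[symmetric] by (rule LIMSEQ_unique)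
qed

text \<open>
  The boundary form of the multiplication of power series.
\<close>

lemma one_sided_fourier_coeff_mult:
  assumes f: "square_integrable f" "\<And>n. n < 0 \<Longrightarrow> fourier_coeff f n = 0"
    and g: "square_integrable g" "\<And>n. n < 0 \<Longrightarrow> fourier_coeff g n = 0"
  shows "n < 0 \<Longrightarrow> fourier_coeff (\<lambda>u. f u * g u) n = 0"
    and "fourier_coeff (\<lambda>u. f u * g u) (int m) = (\<Sum>i\<le>m. fourier_coeff f (int i) * fourier_coeff g (int (m - i)))"
proof -
  have lim: "(\<lambda>N. \<Sum>k\<in>{- int N..int N}. fourier_coeff f k * fourier_coeff g (n - k))
    \<longlonglongrightarrow> fourier_coeff (\<lambda>u. f u * g u) n" for n
    by (rule fourier_coeff_mult[OF f(1) g(1)])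
  {
    assume n: "n < 0"
    then have z: "fourier_coeff f k * fourier_coeff g (n - k) = 0" for k
      using f(2)[of k] g(2)[of "n - k"] by (cases "k < 0") auto
    show "fourier_coeff (\<lambda>u. f u * g u) n = 0"
      using lim[of n] unfolding z by (simp add: LIMSEQ_const_iff)
  }
  have "eventually (\<lambda>N. (\<Sum>k\<in>{- int N..int N}. fourier_coeff f k * fourier_coeff g (int m - k))
      = (\<Sum>i\<le>m. fourier_coeff f (int i) * fourier_coeff g (int (m - i)))) sequentially"
    using eventually_ge_at_top[of m]
  proof eventually_elim
    case (elim N)
    have "(\<Sum>k\<in>{- int N..int N}. fourier_coeff f k * fourier_coeff g (int m - k))
        = (\<Sum>k\<in>int ` {..m}. fourier_coeff f k * fourier_coeff g (int m - k))"
    proof (rule sum.mono_neutral_right)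
      show "\<forall>k\<in>{- int N..int N} - int ` {..m}. fourier_coeff f k * fourier_coeff g (int m - k) = 0"
      proof
        fix k assume k: "k \<in> {- int N..int N} - int ` {..m}"
        have "k < 0 \<or> int m < k"
        proof (rule ccontr)
          assume "\<not> (k < 0 \<or> int m < k)"
          then have "k = int (nat k)" "nat k \<le> m" by auto
          then show False using k by blast
        qed
        then show "fourier_coeff f k * fourier_coeff g (int m - k) = 0"
          using f(2)[of k] g(2)[of "int m - k"] by auto
      qed
    qed (use elim in auto)
    also have "\<dots> = (\<Sum>i\<le>m. fourier_coeff f (int i) * fourier_coeff g (int (m - i)))"
      by (subst sum.reindex) (auto simp: of_nat_diff intro!: sum.cong)
    finally show ?case .
  qed
  then show "fourier_coeff (\<lambda>u. f u * g u) (int m) = (\<Sum>i\<le>m. fourier_coeff f (int i) * fourier_coeff g (int (m - i)))"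
    using LIMSEQ_unique[OF lim[of "int m"] tendsto_eventually] by simp
qed

lemma fourier_coeff_of_real_neg:
  "fourier_coeff (\<lambda>u. complex_of_real (f u)) (- n) = cnj (fourier_coeff (\<lambda>u. complex_of_real (f u)) n)"
  using fourier_coeff_cnj[of "\<lambda>u. complex_of_real (f u)" "- n"] by simp

text \<open>
  The Fourier coefficients of a real function at \<open>n\<close> and \<open>-n\<close> are conjugate, so vanishing on one side
  forces vanishing on the other.
\<close>

lemma real_one_sided_constant:
  fixes \<Phi> :: "real \<Rightarrow> real"
  assumes i: "integrable circle_measure (\<lambda>u. complex_of_real (\<Phi> u))"
    and neg: "\<And>n. n < 0 \<Longrightarrow> fourier_coeff (\<lambda>u. complex_of_real (\<Phi> u)) n = 0"
    and zero: "fourier_coeff (\<lambda>u. complex_of_real (\<Phi> u)) 0 = of_real a"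
  shows "AE u in circle_measure. \<Phi> u = a"
proof -
  have "fourier_coeff (\<lambda>u. complex_of_real (\<Phi> u)) n = fourier_coeff (\<lambda>_. of_real a) n" for n
    using neg[of n] neg[of "- n"] zero fourier_coeff_of_real_neg[of \<Phi> n]
    by (cases n "0 :: int" rule: linorder_cases) (auto simp: fourier_coeff_const)
  from fourier_coeff_unique[OF i square_integrable_integrable[OF square_integrable_const] this]
  show ?thesis by simp
qed

text \<open>
  The choice in the definition of \<open>K_inf\<close> is justified by the Riesz-Fischer theorem as soon as the
  multiplied coefficients are square-summable.
\<close>

lemma K_inf_spec:
  assumes "(\<lambda>n. (cmod (of_int \<bar>n\<bar> * fourier_coeff \<phi> n))\<^sup>2) summable_on UNIV"
  shows "K_inf \<phi> \<in> L2_circle" "fourier_coeff (K_inf \<phi>) n = of_int \<bar>n\<bar> * fourier_coeff \<phi> n"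
proof -
  obtain g where g: "g \<in> L2_circle"
    and lim: "(\<lambda>N. LINT u|circle_measure. (cmod (g u - trig_sum (\<lambda>n. of_int \<bar>n\<bar> * fourier_coeff \<phi> n) N u))\<^sup>2) \<longlonglongrightarrow> 0"
    using Riesz_Fischer[OF assms] by blast
  have "\<forall>n. fourier_coeff g n = of_int \<bar>n\<bar> * fourier_coeff \<phi> n"
    using fourier_coeff_L2_limit[OF L2_circle_square_integrable[OF g] lim] by blast
  then have "\<exists>g. g \<in> L2_circle \<and> (\<forall>n. fourier_coeff g n = of_int \<bar>n\<bar> * fourier_coeff \<phi> n)"
    using g by blast
  from someI_ex[OF this] 
  show "K_inf \<phi> \<in> L2_circle" "fourier_coeff (K_inf \<phi>) n = of_int \<bar>n\<bar> * fourier_coeff \<phi> n"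
    unfolding K_inf_def by auto
qed

lemma AE_dense:
  assumes ae: "AE u in circle_measure. Q u" and xy: "x < y" "{x..y} \<subseteq> {-pi..pi}"
  shows "\<exists>z. x < z \<and> z < y \<and> Q z"
proof (rule ccontr)
  assume "\<not> ?thesis"
  then have no: "\<not> Q z" if "x < z" "z < y" for z using that by blast
  have "AE u in lebesgue. u \<in> {-pi..pi} \<longrightarrow> Q u"
    using ae by (simp add: AE_restrict_space_iff)
  then have "AE u in lebesgue. u \<notin> {x<..<y}"
    by (rule eventually_mono) (use no xy in force)
  then have "emeasure lebesgue {x<..<y} = 0"
    by (subst (asm) AE_iff_measurable[of "{x<..<y}"]) auto
  then show False using xy by simp
qed

text \<open>
  A mean value inequality when \<open>p\<close> is the derivative of \<open>\<eta>\<close> only in the sense of Fourier coefficients.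
  Term by term, \<open>S\<^sub>N \<eta>(y) - S\<^sub>N \<eta>(x)\<close> is the integral of \<open>S\<^sub>N p\<close> over \<open>[x, y]\<close> and converges to the
  integral of \<open>p\<close>. A subsequence of \<open>S\<^sub>N \<eta>\<close> converges to \<open>\<eta>\<close> almost everywhere, which settles all
  endpoints in a dense set; continuity of \<open>\<eta>\<close> gives the others.
\<close>

lemma mean_value_inequality_fourier:
  fixes \<eta> :: "real \<Rightarrow> complex"
  assumes \<eta>: "continuous_on {-pi..pi} \<eta>" and p: "square_integrable p"
    and coeff: "\<And>n. fourier_coeff p n = \<i> * of_int n * fourier_coeff \<eta> n"
    and ab: "-pi \<le> a" "a < b" "b \<le> pi"
    and M: "AE u in circle_measure. u \<in> {a..b} \<longrightarrow> cmod (p u) \<le> M"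
  shows "cmod (\<eta> b - \<eta> a) \<le> M * (b - a)"
proof -
  \<comment> \<open>since \<open>M\<close> is an almost everywhere bound on a nontrivial interval, it is nonnegative\<close>
  obtain u0 where "a < u0" "u0 < b" "u0 \<in> {a..b} \<longrightarrow> cmod (p u0) \<le> M"
    using AE_dense[OF M ab(2)] ab by auto
  then have "cmod (p u0) \<le> M" by simp
  then have M0: "0 \<le> M" using norm_ge_zero order_trans by blast
  obtain B where "\<forall>u\<in>{-pi..pi}. cmod (\<eta> u) \<le> B"
    using continuous_bounded_circle[OF \<eta>] by blast
  then have sq: "square_integrable \<eta>"
    by (intro square_integrable_bounded[OF continuous_imp_measurable_circle[OF \<eta>], of B]) blast
  let ?S = "trig_sum (fourier_coeff \<eta>)" and ?P = "trig_sum (fourier_coeff p)"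
  have "\<exists>r::nat\<Rightarrow>nat. strict_mono r \<and> (AE u in circle_measure. (\<lambda>n. (cmod (\<eta> u - ?S (r n) u))\<^sup>2) \<longlonglongrightarrow> 0)"
  proof (rule tendsto_L1_AE_subseq)
    show "integrable circle_measure (\<lambda>u. (cmod (\<eta> u - ?S n u))\<^sup>2)" for n
      by (intro square_integrable_norm_sq square_integrable_diff sq trig_sum_square_integrable)
    show "(\<lambda>n. LINT u|circle_measure. norm ((cmod (\<eta> u - ?S n u))\<^sup>2)) \<longlonglongrightarrow> 0"
      using fourier_series_L2_converges[OF sq] by simp
  qed
  then obtain r :: "nat \<Rightarrow> nat" where r: "strict_mono r"
    "AE u in circle_measure. (\<lambda>n. (cmod (\<eta> u - ?S (r n) u))\<^sup>2) \<longlonglongrightarrow> 0" by blast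
  define D where "D u \<longleftrightarrow> (\<lambda>n. ?S (r n) u) \<longlonglongrightarrow> \<eta> u" for u
  have D: "AE u in circle_measure. D u"
    using r(2)
  proof eventually_elim
    case (elim u)
    from tendsto_real_sqrt[OF this] have "(\<lambda>n. norm (\<eta> u - ?S (r n) u)) \<longlonglongrightarrow> 0" by simp
    then have "(\<lambda>n. \<eta> u - ?S (r n) u) \<longlonglongrightarrow> 0" by (rule tendsto_norm_zero_cancel)
    from tendsto_diff[OF tendsto_const[of "\<eta> u"] this] show ?case by (simp add: D_def)
  qed
  have mv: "cmod (\<eta> y - \<eta> x) \<le> M * (y - x)" if xy: "a \<le> x" "x < y" "y \<le> b" "D x" "D y" for x y
  proof -
    define I where "I u = (indicator {x..y} u :: complex)" for u :: real
    have mI: "I \<in> borel_measurable circle_measure"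
    proof -
      have "I \<in> borel_measurable lebesgue" unfolding I_def by (intro borel_measurable_indicator) simp
      then show ?thesis by (rule measurable_restrict_space1)
    qed
    have sI: "square_integrable I"
      by (rule square_integrable_bounded[OF mI, of 1]) (simp add: I_def indicator_def)
    have im: "(LINT u|circle_measure. fourier_coeff p n * mode n u * I u) = fourier_coeff \<eta> n * (mode n y - mode n x)" for n
    proof (cases "n = 0")
      case False
      have "((\<lambda>u. fourier_coeff p n * mode n u) has_integral fourier_coeff \<eta> n * mode n y - fourier_coeff \<eta> n * mode n x) {x..y}"
      proof (rule fundamental_theorem_of_calculus)
        fix u :: real
        have "((\<lambda>u. fourier_coeff \<eta> n * exp (\<i> * of_int n * of_real u)) has_vector_derivative
            fourier_coeff \<eta> n * (\<i> * of_int n * exp (\<i> * of_int n * of_real u))) (at u within {x..y})"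
          by (auto intro!: derivative_eq_intros has_vector_derivative_real_field)
        then show "((\<lambda>u. fourier_coeff \<eta> n * mode n u) has_vector_derivative fourier_coeff p n * mode n u) (at u within {x..y})"
          by (simp add: mode_def cis_conv_exp coeff mult_ac)
      qed (use xy in simp)
      then have i: "integral {x..y} (\<lambda>u. fourier_coeff p n * mode n u) = fourier_coeff \<eta> n * (mode n y - mode n x)"
        unfolding right_diff_distrib by (rule integral_unique)
      have sub: "{x..y} \<subseteq> {-pi..pi}" using xy ab by auto
      have ii: "integrable circle_measure (\<lambda>u. fourier_coeff p n * mode n u * I u)"
        by (intro square_integrable_mult square_integrable_cmult square_integrable_mode sI)
      have "(LINT u|circle_measure. fourier_coeff p n * mode n u * I u) = integral {-pi..pi} (\<lambda>u. fourier_coeff p n * mode n u * I u)"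
        by (rule lebesgue_integral_eq_integral[OF ii]) simp
      also have "\<dots> = integral {-pi..pi} (\<lambda>u. if u \<in> {x..y} then fourier_coeff p n * mode n u else 0)"
        by (intro integral_cong) (simp add: I_def)
      also have "\<dots> = integral {x..y} (\<lambda>u. fourier_coeff p n * mode n u)"
        unfolding integral_restrict_Int using sub by (simp only: Int_absorb2)
      finally show ?thesis using i by simp
    qed (simp add: coeff)
    have "(LINT u|circle_measure. ?P N u * I u) = ?S N y - ?S N x" for N
    proof -
      have "(LINT u|circle_measure. ?P N u * I u) = (LINT u|circle_measure. (\<Sum>n\<in>{- int N..int N}. fourier_coeff p n * mode n u * I u))"
        by (simp add: trig_sum_def sum_distrib_right)
      also have "\<dots> = (\<Sum>n\<in>{- int N..int N}. LINT u|circle_measure. fourier_coeff p n * mode n u * I u)"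
        by (rule Bochner_Integration.integral_sum) (intro square_integrable_mult square_integrable_cmult square_integrable_mode sI)
      also have "\<dots> = ?S N y - ?S N x"
        unfolding im trig_sum_def by (simp add: right_diff_distrib sum_subtractf)
      finally show ?thesis .
    qed
    then have "(\<lambda>N. ?S N y - ?S N x) \<longlonglongrightarrow> (LINT u|circle_measure. p u * I u)"
      using L2_limit_mult[OF trig_sum_square_integrable p sI fourier_series_L2_converges[OF p]] by simp
    from LIMSEQ_subseq_LIMSEQ[OF this r(1)]
    have "(\<lambda>n. ?S (r n) y - ?S (r n) x) \<longlonglongrightarrow> (LINT u|circle_measure. p u * I u)" by (simp add: o_def)
    moreover have "(\<lambda>n. ?S (r n) y - ?S (r n) x) \<longlonglongrightarrow> \<eta> y - \<eta> x"
      using xy by (intro tendsto_diff) (simp_all add: D_def)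
    ultimately have eq: "\<eta> y - \<eta> x = (LINT u|circle_measure. p u * I u)"
      using LIMSEQ_unique by blast
    have "cmod (\<eta> y - \<eta> x) \<le> (LINT u|circle_measure. cmod (p u * I u))"
      unfolding eq by (rule integral_norm_bound)
    also have "\<dots> \<le> (LINT u|circle_measure. M * indicator {x..y} u)"
    proof (rule integral_mono_AE)
      show "integrable circle_measure (\<lambda>u. cmod (p u * I u))"
        by (intro integrable_norm square_integrable_mult p sI)
      have "integrable circle_measure (\<lambda>u. Re (of_real M * I u))"
        by (intro integrable_Re square_integrable_integrable square_integrable_cmult sI)
      then show "integrable circle_measure (\<lambda>u. M * indicator {x..y} u)"
        by (rule Bochner_Integration.integrable_cong[OF refl, THEN iffD1, rotated]) (simp add: I_def indicator_def)
      show "AE u in circle_measure. cmod (p u * I u) \<le> M * indicator {x..y} u"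
        using M by eventually_elim (use xy in \<open>auto simp: I_def indicator_def\<close>)
    qed
    also have "\<dots> = M * (y - x)"
      using xy ab by (simp add: measure_restrict_space Int_absorb2 Int_absorb1)
    finally show ?thesis .
  qed
  \<comment> \<open>extend from the dense set \<open>D\<close> by continuity\<close>
  show ?thesis
  proof (rule field_le_epsilon)
    fix e :: real assume e: "e > 0"
    have "\<exists>d>0. \<forall>y\<in>{-pi..pi}. \<bar>y - x\<bar> < d \<longrightarrow> cmod (\<eta> y - \<eta> x) < e / 2" if "x \<in> {-pi..pi}" for x
      using \<eta> that e unfolding continuous_on_iff dist_norm real_norm_def by (metis half_gt_zero)
    from this[of a] this[of b] ab obtain d1 d2 where
      d1: "d1 > 0" "\<And>y. y \<in> {-pi..pi} \<Longrightarrow> \<bar>y - a\<bar> < d1 \<Longrightarrow> cmod (\<eta> y - \<eta> a) < e / 2" and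
      d2: "d2 > 0" "\<And>y. y \<in> {-pi..pi} \<Longrightarrow> \<bar>y - b\<bar> < d2 \<Longrightarrow> cmod (\<eta> y - \<eta> b) < e / 2" by auto
    define d where "d = min (min d1 d2) ((b - a) / 2)"
    have d: "0 < d" "d \<le> d1" "d \<le> d2" using d1(1) d2(1) ab by (auto simp: d_def)
    have d4: "d \<le> (b - a) / 2" unfolding d_def by (rule min.cobounded2)
    obtain x where x: "a < x" "x < a + d" "D x"
      using AE_dense[OF D, of a "a + d"] d(1) d4 ab by force
    obtain y where y: "b - d < y" "y < b" "D y"
      using AE_dense[OF D, of "b - d" b] d(1) d4 ab by force
    have "2 * d \<le> b - a" using d4 by simp
    then have "x < y" using x(2) y(1) by linarith
    have "cmod (\<eta> y - \<eta> x) \<le> M * (y - x)" by (rule mv) (use x y \<open>x < y\<close> in auto)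
    also have "\<dots> \<le> M * (b - a)" using M0 x y by (intro mult_left_mono) auto
    finally have 1: "cmod (\<eta> y - \<eta> x) \<le> M * (b - a)" .
    have 2: "cmod (\<eta> x - \<eta> a) < e / 2" by (rule d1(2)) (use x y \<open>x < y\<close> d ab in auto)
    have 3: "cmod (\<eta> y - \<eta> b) < e / 2" by (rule d2(2)) (use x y \<open>x < y\<close> d ab in auto)
    have split: "\<eta> b - \<eta> a = (\<eta> y - \<eta> x) - (\<eta> y - \<eta> b) + (\<eta> x - \<eta> a)" by simp
    have "cmod (\<eta> b - \<eta> a) \<le> cmod (\<eta> y - \<eta> x) + cmod (\<eta> y - \<eta> b) + cmod (\<eta> x - \<eta> a)"
      unfolding split using norm_triangle_ineq[of "(\<eta> y - \<eta> x) - (\<eta> y - \<eta> b)" "\<eta> x - \<eta> a"]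
        norm_triangle_ineq4[of "\<eta> y - \<eta> x" "\<eta> y - \<eta> b"] by linarith
    then show "cmod (\<eta> b - \<eta> a) \<le> M * (b - a) + e" using 1 2 3 by linarith
  qed
qed

section \<open>From the Babenko equation to the Bernoulli law\<close>

text \<open>
  The function \<open>f = 1 + K \<eta> - \<i> \<eta>'\<close>: the coefficients \<open>\<bar>n\<bar> \<eta>\<^sub>n\<close> of \<open>K \<eta>\<close> and \<open>n \<eta>\<^sub>n\<close> of \<open>-\<i> \<eta>'\<close> cancel for
  \<open>n < 0\<close> and add up for \<open>n > 0\<close>.
\<close>

lemma obtain_analytic_derivative:
  fixes \<eta> :: "real \<Rightarrow> real"
  assumes dom: "(\<lambda>u. complex_of_real (\<eta> u)) \<in> Dom_K_inf"
  obtains f where "square_integrable f"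
    "\<And>n. fourier_coeff f n = (if n < 0 then 0 else if n = 0 then 1 else 2 * of_int n * fourier_coeff (\<lambda>u. complex_of_real (\<eta> u)) n)"
proof -
  let ?E = "fourier_coeff (\<lambda>u. complex_of_real (\<eta> u))"
  define a where "a n = (if n < 0 then 0 else if n = 0 then 1 else 2 * of_int n * ?E n)" for n :: int
  have s: "(\<lambda>n::int. (of_int n)\<^sup>2 * (cmod (?E n))\<^sup>2) summable_on UNIV"
    using dom by (simp add: Dom_K_inf_def)
  have "(\<lambda>n. (cmod (a n))\<^sup>2) summable_on (UNIV - {0})"
  proof (rule summable_on_comparison_test)
    show "(\<lambda>n::int. 4 * ((of_int n)\<^sup>2 * (cmod (?E n))\<^sup>2)) summable_on (UNIV - {0})"
      by (intro summable_on_cmult_right summable_on_subset_banach[OF s]) auto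
    show "(cmod (a n))\<^sup>2 \<le> 4 * ((of_int n)\<^sup>2 * (cmod (?E n))\<^sup>2)" if "n \<in> UNIV - {0}" for n
      using that by (simp add: a_def norm_mult power_mult_distrib)
  qed auto
  then have "(\<lambda>n. (cmod (a n))\<^sup>2) summable_on (insert 0 (UNIV - {0}))"
    by (simp only: summable_on_insert_iff)
  then have "(\<lambda>n. (cmod (a n))\<^sup>2) summable_on UNIV" by (simp add: insert_absorb)
  then obtain f where f: "f \<in> L2_circle" "(\<lambda>N. LINT u|circle_measure. (cmod (f u - trig_sum a N u))\<^sup>2) \<longlonglongrightarrow> 0"
    using Riesz_Fischer by blast
  note sq = L2_circle_square_integrable[OF f(1)]
  show thesis by (rule that[OF sq]) (simp add: fourier_coeff_L2_limit[OF sq f(2)] a_def)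
qed

lemma fourier_coeff_Re_Im:
  assumes f: "square_integrable f"
  shows "square_integrable (\<lambda>u. of_real (Re (f u)))"
    "square_integrable (\<lambda>u. of_real (Im (f u)))"
    "fourier_coeff (\<lambda>u. of_real (Re (f u))) n = (fourier_coeff f n + cnj (fourier_coeff f (- n))) / 2"
    "fourier_coeff (\<lambda>u. of_real (Im (f u))) n = (fourier_coeff f n - cnj (fourier_coeff f (- n))) / (2 * \<i>)"
proof -
  have re: "(\<lambda>u. complex_of_real (Re (f u))) = (\<lambda>u. (1/2) * (f u + cnj (f u)))"
    by (simp add: fun_eq_iff complex_eq_iff)
  have im: "(\<lambda>u. complex_of_real (Im (f u))) = (\<lambda>u. (1/(2*\<i>)) * (f u - cnj (f u)))"
    by (simp add: fun_eq_iff complex_eq_iff)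
  note c = square_integrable_cnj[OF f]
  show "square_integrable (\<lambda>u. of_real (Re (f u)))" "square_integrable (\<lambda>u. of_real (Im (f u)))"
    unfolding re im by (intro square_integrable_cmult square_integrable_add square_integrable_diff f c)+
  note i = square_integrable_integrable[OF f] square_integrable_integrable[OF c]
  show "fourier_coeff (\<lambda>u. of_real (Re (f u))) n = (fourier_coeff f n + cnj (fourier_coeff f (- n))) / 2"
    unfolding re fourier_coeff_cmult fourier_coeff_add[OF i] fourier_coeff_cnj by simp
  show "fourier_coeff (\<lambda>u. of_real (Im (f u))) n = (fourier_coeff f n - cnj (fourier_coeff f (- n))) / (2 * \<i>)"
    unfolding im fourier_coeff_cmult fourier_coeff_diff[OF i] fourier_coeff_cnj by simp
qed

text \<open>
  Since \<open>\<eta>\<close> is real, \<open>\<eta>'\<close> and \<open>1 + K \<eta>\<close> are recovered as \<open>- Im f\<close> and \<open>Re f\<close>.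
\<close>

lemma analytic_derivative_parts:
  fixes \<eta> :: "real \<Rightarrow> real"
  assumes f: "square_integrable f"
    "\<And>n. fourier_coeff f n = (if n < 0 then 0 else if n = 0 then 1 else 2 * of_int n * fourier_coeff (\<lambda>u. complex_of_real (\<eta> u)) n)"
  shows "fourier_coeff (\<lambda>u. of_real (- Im (f u))) n = \<i> * of_int n * fourier_coeff (\<lambda>u. complex_of_real (\<eta> u)) n"
    "fourier_coeff (\<lambda>u. of_real (Re (f u) - 1)) n = of_int \<bar>n\<bar> * fourier_coeff (\<lambda>u. complex_of_real (\<eta> u)) n"
proof -
  have neg: "cnj (fourier_coeff (\<lambda>u. complex_of_real (\<eta> u)) (- n)) = fourier_coeff (\<lambda>u. complex_of_real (\<eta> u)) n" for n
    using fourier_coeff_of_real_neg[of \<eta> n] by simp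
  note RI = fourier_coeff_Re_Im[OF f(1)]
  have "fourier_coeff (\<lambda>u. of_real (- Im (f u))) n = - fourier_coeff (\<lambda>u. of_real (Im (f u))) n"
    using fourier_coeff_cmult[of "- 1" "\<lambda>u. of_real (Im (f u))" n] by simp
  then show "fourier_coeff (\<lambda>u. of_real (- Im (f u))) n = \<i> * of_int n * fourier_coeff (\<lambda>u. complex_of_real (\<eta> u)) n"
    unfolding RI(4) using neg[of n] by (cases n "0 :: int" rule: linorder_cases) (auto simp: f(2) field_simps)
  have "fourier_coeff (\<lambda>u. of_real (Re (f u)) - 1) n = fourier_coeff (\<lambda>u. of_real (Re (f u))) n - fourier_coeff (\<lambda>_. 1) n"
    by (intro fourier_coeff_diff square_integrable_integrable RI(1) square_integrable_const)
  then show "fourier_coeff (\<lambda>u. of_real (Re (f u) - 1)) n = of_int \<bar>n\<bar> * fourier_coeff (\<lambda>u. complex_of_real (\<eta> u)) n"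
    unfolding RI(3) using neg[of n]
    by (cases n "0 :: int" rule: linorder_cases) (auto simp: f(2) fourier_coeff_const field_simps)
qed

text \<open>
  With \<open>E = \<eta>\<close>, \<open>k = K \<eta>\<close>, \<open>P = \<eta>'\<close> and \<open>G = (c\<^sup>2/2 - \<eta>) (1 + k + \<i> P)\<close>, the Leibniz rule
  \<open>2 (E P)\<^sub>n = \<i> n (E\<^sup>2)\<^sub>n\<close> turns the term \<open>\<bar>n\<bar> (E\<^sup>2)\<^sub>n / 2\<close> of the Babenko equation into \<open>\<i> (E P)\<^sub>n\<close> for
  \<open>n < 0\<close>. The \<open>n\<close>-th coefficient of the equation then says that the \<open>n\<close>-th coefficient of \<open>G\<close>
  vanishes; the coefficient at \<open>0\<close> fixes the mean value. The product \<open>f G = (c\<^sup>2/2 - \<eta>) \<bar>f\<bar>\<^sup>2\<close> of two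
  functions with modes \<open>n \<ge> 0\<close> is real, hence constant.
\<close>

lemma Babenko_imp_Bernoulli:
  fixes c :: real and \<eta> :: "real \<Rightarrow> real"
  assumes dom: "(\<lambda>u. complex_of_real (\<eta> u)) \<in> Dom_K_inf"
    and cont: "continuous_on {-pi..pi} \<eta>"
    and eq: "AE u in circle_measure.
           (of_real (c\<^sup>2) * K_inf (\<lambda>s. of_real (\<eta> s)) u - of_real (\<eta> u))
           - of_real (\<eta> u) * K_inf (\<lambda>s. of_real (\<eta> s)) u
           - 1 / 2 * K_inf (\<lambda>s. of_real ((\<eta> s)\<^sup>2)) u = 0"
    and f: "square_integrable f"
    "\<And>n. fourier_coeff f n = (if n < 0 then 0 else if n = 0 then 1 else 2 * of_int n * fourier_coeff (\<lambda>u. complex_of_real (\<eta> u)) n)"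
  shows "square_integrable (\<lambda>u. of_real (c\<^sup>2 / 2 - \<eta> u) * cnj (f u))"
    "\<And>n. n < 0 \<Longrightarrow> fourier_coeff (\<lambda>u. of_real (c\<^sup>2 / 2 - \<eta> u) * cnj (f u)) n = 0"
    "\<And>n. fourier_coeff (\<lambda>u. f u * (of_real (c\<^sup>2 / 2 - \<eta> u) * cnj (f u))) n = (if n = 0 then of_real (c\<^sup>2 / 2) else 0)"
    "AE u in circle_measure. (c\<^sup>2 / 2 - \<eta> u) * (cmod (f u))\<^sup>2 = c\<^sup>2 / 2"
proof -
  define E where "E u = complex_of_real (\<eta> u)" for u
  define P where "P u = complex_of_real (- Im (f u))" for u
  define k where "k = K_inf E"
  define k2 where "k2 = K_inf (\<lambda>u. E u * E u)"
  define G where "G u = of_real (c\<^sup>2 / 2 - \<eta> u) * cnj (f u)" for u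
  have E_eq: "(\<lambda>u. complex_of_real (\<eta> u)) = E" "(\<lambda>u. complex_of_real ((\<eta> u)\<^sup>2)) = (\<lambda>u. E u * E u)"
    by (simp_all add: E_def fun_eq_iff power2_eq_square)
  have cE: "continuous_on {-pi..pi} E"
    unfolding E_def by (intro continuous_intros cont)
  then have mE: "E \<in> borel_measurable circle_measure"
    by (rule continuous_imp_measurable_circle)
  obtain B where "\<forall>u\<in>{-pi..pi}. cmod (E u) \<le> B"
    using continuous_bounded_circle[OF cE] by blast
  then have B: "cmod (E u) \<le> B" if "u \<in> {-pi..pi}" for u using that by blast
  have mult_E: "square_integrable (\<lambda>u. E u * g u)" if "square_integrable g" for g
    by (rule square_integrable_bounded_mult[OF that mE B])
  have sE: "square_integrable E" by (rule square_integrable_bounded[OF mE B])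
  note RI = fourier_coeff_Re_Im[OF f(1)]
  have sP: "square_integrable P"
    using square_integrable_cmult[OF RI(2), of "-1"] by (simp add: P_def[abs_def])
  have cP: "fourier_coeff P n = \<i> * of_int n * fourier_coeff E n" for n
    using analytic_derivative_parts(1)[OF f] by (simp add: P_def[abs_def] E_eq)
  have sq_coeff: "2 * fourier_coeff (\<lambda>u. E u * P u) n = \<i> * of_int n * fourier_coeff (\<lambda>u. E u * E u) n" for n
    using fourier_coeff_Leibniz[OF sE sP sE sP cP cP, of n] by (simp add: mult.commute)
  have k: "k \<in> L2_circle" "fourier_coeff k n = of_int \<bar>n\<bar> * fourier_coeff E n" for n
  proof -
    have "(\<lambda>n. (cmod (of_int \<bar>n\<bar> * fourier_coeff E n))\<^sup>2) summable_on UNIV"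
      using dom by (simp add: Dom_K_inf_def E_eq norm_mult power_mult_distrib)
    from K_inf_spec[OF this] show "k \<in> L2_circle" "fourier_coeff k n = of_int \<bar>n\<bar> * fourier_coeff E n"
      by (auto simp: k_def)
  qed
  \<comment> \<open>by the Leibniz rule \<open>(\<eta>\<^sup>2)' = 2 \<eta> \<eta>'\<close> is square-integrable, so \<open>\<eta>\<^sup>2\<close> is in the domain of \<open>K\<close>\<close>
  have k2: "k2 \<in> L2_circle" "fourier_coeff k2 n = of_int \<bar>n\<bar> * fourier_coeff (\<lambda>u. E u * E u) n" for n
  proof -
    have n: "(cmod (of_int \<bar>n\<bar> * fourier_coeff (\<lambda>u. E u * E u) n))\<^sup>2 = 4 * (cmod (fourier_coeff (\<lambda>u. E u * P u) n))\<^sup>2" for n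
    proof -
      have "cmod (of_int \<bar>n\<bar> * fourier_coeff (\<lambda>u. E u * E u) n) = cmod (\<i> * of_int n * fourier_coeff (\<lambda>u. E u * E u) n)"
        by (simp add: norm_mult)
      also have "\<dots> = 2 * cmod (fourier_coeff (\<lambda>u. E u * P u) n)"
        unfolding sq_coeff[symmetric] by (simp add: norm_mult)
      finally show ?thesis by (simp add: power_mult_distrib)
    qed
    have "(\<lambda>n. (cmod (of_int \<bar>n\<bar> * fourier_coeff (\<lambda>u. E u * E u) n))\<^sup>2) summable_on UNIV"
      unfolding n by (intro summable_on_cmult_right Bessel_summable mult_E sP)
    from K_inf_spec[OF this] show "k2 \<in> L2_circle" "fourier_coeff k2 n = of_int \<bar>n\<bar> * fourier_coeff (\<lambda>u. E u * E u) n"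
      by (auto simp: k2_def)
  qed
  note sk = L2_circle_square_integrable[OF k(1)] and sk2 = L2_circle_square_integrable[OF k2(1)]
  have babenko: "of_real (c\<^sup>2) * (of_int \<bar>n\<bar> * fourier_coeff E n) - fourier_coeff E n - fourier_coeff (\<lambda>u. E u * k u) n
     - 1 / 2 * (of_int \<bar>n\<bar> * fourier_coeff (\<lambda>u. E u * E u) n) = 0" for n
  proof -
    define Q where "Q u = (of_real (c\<^sup>2) * k u - E u) - E u * k u - 1 / 2 * k2 u" for u
    have "AE u in circle_measure. Q u = 0"
      using eq unfolding E_eq Q_def k_def k2_def by (simp add: E_def)
    moreover have "square_integrable Q"
      unfolding Q_def by (intro square_integrable_diff square_integrable_cmult sk sE sk2 mult_E)
    ultimately have "fourier_coeff Q n = fourier_coeff (\<lambda>_. 0) n"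
      by (intro fourier_coeff_cong_AE) (auto dest: square_integrable_measurable)
    moreover have "fourier_coeff Q n = of_real (c\<^sup>2) * fourier_coeff k n - fourier_coeff E n - fourier_coeff (\<lambda>u. E u * k u) n - 1 / 2 * fourier_coeff k2 n"
      unfolding Q_def
      by (subst fourier_coeff_diff fourier_coeff_cmult | intro square_integrable_integrable square_integrable_diff square_integrable_cmult sk sE sk2 mult_E)+ (rule refl)
    ultimately show ?thesis by (simp add: k(2) k2(2) fourier_coeff_const)
  qed
  have ae: "AE u in circle_measure. k u = of_real (Re (f u) - 1)"
  proof (rule fourier_coeff_unique)
    show "integrable circle_measure (\<lambda>u. complex_of_real (Re (f u) - 1))"
      using square_integrable_integrable[OF square_integrable_diff[OF RI(1) square_integrable_const[of 1]]] by simp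
    show "fourier_coeff k n = fourier_coeff (\<lambda>u. complex_of_real (Re (f u) - 1)) n" for n
      unfolding k(2) analytic_derivative_parts(2)[OF f] E_eq ..
  qed (rule square_integrable_integrable[OF sk])
  have sf: "square_integrable (\<lambda>u. cnj (f u))" by (rule square_integrable_cnj[OF f(1)])
  define G' where "G' u = of_real (c\<^sup>2 / 2) * cnj (f u) - (E u + E u * k u + \<i> * (E u * P u))" for u
  have sG': "square_integrable G'"
    unfolding G'_def by (intro square_integrable_diff square_integrable_add square_integrable_cmult sf mult_E sE sk sP)
  have G_expand: "G u = of_real (c\<^sup>2 / 2) * cnj (f u) - E u * cnj (f u)" for u
    by (simp add: G_def E_def algebra_simps)
  show sG: "square_integrable (\<lambda>u. of_real (c\<^sup>2 / 2 - \<eta> u) * cnj (f u))"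
    unfolding G_def[symmetric] G_expand by (intro square_integrable_diff square_integrable_cmult sf mult_E)
  have sG1: "square_integrable G" using sG by (simp add: G_def[abs_def])
  have "AE u in circle_measure. G u = G' u"
    using ae
  proof eventually_elim
    case (elim u)
    have "cnj (f u) = 1 + k u + \<i> * P u" by (simp add: elim P_def complex_eq_iff)
    then show ?case unfolding G_expand G'_def by (simp add: algebra_simps)
  qed
  then have cG: "fourier_coeff G n = of_real (c\<^sup>2 / 2) * cnj (fourier_coeff f (- n))
      - (fourier_coeff E n + fourier_coeff (\<lambda>u. E u * k u) n + \<i> * fourier_coeff (\<lambda>u. E u * P u) n)" for n
  proof -
    have "fourier_coeff G n = fourier_coeff G' n"
      using \<open>AE u in circle_measure. G u = G' u\<close> sG1 sG' by (intro fourier_coeff_cong_AE square_integrable_measurable)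
    also have "\<dots> = of_real (c\<^sup>2 / 2) * fourier_coeff (\<lambda>u. cnj (f u)) n
      - (fourier_coeff E n + fourier_coeff (\<lambda>u. E u * k u) n + \<i> * fourier_coeff (\<lambda>u. E u * P u) n)"
      unfolding G'_def
      by (subst fourier_coeff_diff fourier_coeff_add fourier_coeff_cmult | intro square_integrable_integrable square_integrable_add square_integrable_cmult sf sE mult_E sk sP)+ (rule refl)
    finally show ?thesis by (simp add: fourier_coeff_cnj)
  qed
  have Gneg: "fourier_coeff G n = 0" if n: "n < 0" for n
  proof -
    have "cnj (fourier_coeff f (- n)) = 2 * of_int \<bar>n\<bar> * fourier_coeff E n"
      using n fourier_coeff_of_real_neg[of \<eta> n] by (simp add: f(2) E_eq)
    moreover have "\<i> * fourier_coeff (\<lambda>u. E u * P u) n = 1 / 2 * (of_int \<bar>n\<bar> * fourier_coeff (\<lambda>u. E u * E u) n)"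
    proof -
      have "\<i> * (2 * fourier_coeff (\<lambda>u. E u * P u) n) = of_int \<bar>n\<bar> * fourier_coeff (\<lambda>u. E u * E u) n"
        unfolding sq_coeff using n by (simp flip: mult.assoc)
      then show ?thesis by (simp add: mult_ac)
    qed
    ultimately show ?thesis unfolding cG using babenko[of n] by (simp add: algebra_simps)
  qed
  have G0: "fourier_coeff G 0 = of_real (c\<^sup>2 / 2)"
    unfolding cG using babenko[of 0] sq_coeff[of 0] by (simp add: f(2) algebra_simps add_eq_0_iff)
  show "fourier_coeff (\<lambda>u. of_real (c\<^sup>2 / 2 - \<eta> u) * cnj (f u)) n = 0" if "n < 0" for n
    using Gneg[OF that] by (simp add: G_def[abs_def])
  define \<Phi> where "\<Phi> u = (c\<^sup>2 / 2 - \<eta> u) * (cmod (f u))\<^sup>2" for u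
  have fG: "f u * G u = of_real (\<Phi> u)" for u
    using complex_norm_square[of "f u"] by (simp add: G_def \<Phi>_def mult_ac)
  have fneg: "fourier_coeff f n = 0" if "n < 0" for n using that by (simp add: f(2))
  note os = one_sided_fourier_coeff_mult[OF f(1) fneg sG1 Gneg, unfolded fG]
  have 0: "fourier_coeff (\<lambda>u. of_real (\<Phi> u)) 0 = of_real (c\<^sup>2 / 2)"
    using os(2)[of 0] G0 by (simp add: f(2))
  have iPhi: "integrable circle_measure (\<lambda>u. complex_of_real (\<Phi> u))"
    using square_integrable_mult[OF f(1) sG1] by (simp add: fG)
  have ae\<Phi>: "AE u in circle_measure. \<Phi> u = c\<^sup>2 / 2"
    by (rule real_one_sided_constant[OF iPhi os(1) 0])
  then show "AE u in circle_measure. (c\<^sup>2 / 2 - \<eta> u) * (cmod (f u))\<^sup>2 = c\<^sup>2 / 2"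
    by (simp add: \<Phi>_def)
  have "fourier_coeff (\<lambda>u. of_real (\<Phi> u)) n = fourier_coeff (\<lambda>_. of_real (c\<^sup>2 / 2)) n" for n
  proof (rule fourier_coeff_cong_AE)
    show "AE u in circle_measure. complex_of_real (\<Phi> u) = of_real (c\<^sup>2 / 2)"
      using ae\<Phi> by eventually_elim (simp only:)
  qed (use iPhi in auto)
  then show "fourier_coeff (\<lambda>u. f u * (of_real (c\<^sup>2 / 2 - \<eta> u) * cnj (f u))) n = (if n = 0 then of_real (c\<^sup>2 / 2) else 0)" for n
    unfolding G_def[symmetric] fG by (simp add: fourier_coeff_const)
qed

section \<open>The exponent at the crest\<close>

text \<open>
  The dyadic difference \<open>\<eta>(x) - \<eta>(2x)\<close> is at least a positive multiple of \<open>x powr \<beta>\<close> by the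
  asymptotics, and at most a multiple of \<open>\<bar>c\<bar> x powr (1 - \<beta>/2)\<close> by the Bernoulli law and the mean value
  inequality. Working on \<open>[x, 2x]\<close> keeps the singularity of \<open>\<eta>'\<close> at the crest out of the argument.
\<close>

lemma exponent_lower_bound:
  fixes c A \<beta> :: real and \<eta> :: "real \<Rightarrow> real"
  assumes A: "A > 0" and \<beta>: "0 < \<beta>"
    and cont: "continuous_on {-pi..pi} \<eta>"
    and f: "square_integrable f"
    and deriv: "\<And>n. fourier_coeff (\<lambda>u. of_real (- Im (f u))) n = \<i> * of_int n * fourier_coeff (\<lambda>u. complex_of_real (\<eta> u)) n"
    and bernoulli: "AE u in circle_measure. (c\<^sup>2 / 2 - \<eta> u) * (cmod (f u))\<^sup>2 = c\<^sup>2 / 2"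
    and asymp: "(\<lambda>u. \<eta> u - (c\<^sup>2 / 2 - A * \<bar>u\<bar> powr \<beta>)) \<in> o[at 0](\<lambda>u. \<bar>u\<bar> powr \<beta>)"
  shows "c \<noteq> 0" and "2 / 3 \<le> \<beta>"
proof -
  define v where "v u = c\<^sup>2 / 2 - \<eta> u" for u
  define \<kappa> where "\<kappa> = A * (2 powr \<beta> - 1) / 2"
  \<comment> \<open>small enough for \<open>v \<ge> (A/2) \<bar>u\<bar> powr \<beta>\<close> near \<open>0\<close> and for the error not to exceed half of the dyadic difference\<close>
  define e where "e = min (A / 2) (\<kappa> / (2 powr \<beta> + 1))"
  define D where "D = sqrt (c\<^sup>2 / A)"
  have p2: "1 < (2::real) powr \<beta>" using \<beta> by simp
  have \<kappa>: "\<kappa> > 0" using A p2 by (simp add: \<kappa>_def)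
  have e: "e > 0" "e \<le> A / 2" "e * (2 powr \<beta> + 1) \<le> \<kappa>"
  proof -
    have "e \<le> \<kappa> / (2 powr \<beta> + 1)" by (simp add: e_def)
    then show "e * (2 powr \<beta> + 1) \<le> \<kappa>" using p2 by (simp add: pos_le_divide_eq)
    show "e > 0" using A \<kappa> p2 by (auto simp: e_def intro!: divide_pos_pos)
    show "e \<le> A / 2" unfolding e_def by (rule min.cobounded1)
  qed
  have "eventually (\<lambda>u. \<bar>\<eta> u - (c\<^sup>2 / 2 - A * \<bar>u\<bar> powr \<beta>)\<bar> \<le> e * \<bar>u\<bar> powr \<beta>) (at 0)"
    using landau_o.smallD[OF asymp e(1)] by simp
  then obtain d where d: "d > 0" "\<And>u. u \<noteq> 0 \<Longrightarrow> \<bar>u\<bar> < d \<Longrightarrow> \<bar>\<eta> u - (c\<^sup>2 / 2 - A * \<bar>u\<bar> powr \<beta>)\<bar> \<le> e * \<bar>u\<bar> powr \<beta>"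
    unfolding eventually_at by (auto simp: dist_real_def)
  have v: "\<bar>v u - A * u powr \<beta>\<bar> \<le> e * u powr \<beta>" if "0 < u" "u < d" for u
    using d(2)[of u] that by (auto simp: v_def abs_le_iff)
  have main: "\<kappa> * x powr \<beta> \<le> D * x powr (1 - \<beta> / 2)" if x: "0 < x" "2 * x < d" "2 * x \<le> pi" for x
  proof -
    have ae: "AE u in circle_measure. u \<in> {x..2*x} \<longrightarrow> cmod (of_real (- Im (f u))) \<le> D * x powr (- (\<beta> / 2))"
      using bernoulli
    proof eventually_elim
      case (elim u)
      show ?case
      proof
        assume u: "u \<in> {x..2*x}"
        have xu: "x powr \<beta> \<le> u powr \<beta>" using u x \<beta> by (intro powr_mono2) auto
        have "\<bar>v u - A * u powr \<beta>\<bar> \<le> e * u powr \<beta>" using u x by (intro v) auto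
        moreover have "e * u powr \<beta> \<le> A / 2 * u powr \<beta>"
          using e(2) by (intro mult_right_mono) auto
        ultimately have "A / 2 * u powr \<beta> \<le> v u" by linarith
        moreover have "A / 2 * x powr \<beta> \<le> A / 2 * u powr \<beta>"
          using A xu by (intro mult_left_mono) auto
        ultimately have vx: "A / 2 * x powr \<beta> \<le> v u" by linarith
        have "(A / 2 * x powr \<beta>) * (cmod (f u))\<^sup>2 \<le> v u * (cmod (f u))\<^sup>2"
          using vx by (intro mult_right_mono) auto
        then have "(cmod (f u))\<^sup>2 * (A * x powr \<beta>) \<le> c\<^sup>2"
          using elim by (simp add: v_def mult_ac)
        then have "(cmod (f u))\<^sup>2 \<le> c\<^sup>2 / (A * x powr \<beta>)"
          using A x by (simp add: pos_le_divide_eq)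
        also have "\<dots> = (D * x powr (- (\<beta> / 2)))\<^sup>2"
        proof -
          have "(x powr (- (\<beta> / 2)))\<^sup>2 = x powr (- \<beta>)"
            using x by (simp add: power2_eq_square powr_add[symmetric])
          moreover have "D\<^sup>2 = c\<^sup>2 / A" using A by (simp add: D_def)
          ultimately show ?thesis by (simp add: power_mult_distrib powr_minus field_simps)
        qed
        finally have "cmod (f u) \<le> D * x powr (- (\<beta> / 2))"
          by (rule power2_le_imp_le) (use A in \<open>simp add: D_def\<close>)
        then show "cmod (of_real (- Im (f u))) \<le> D * x powr (- (\<beta> / 2))"
          using abs_Im_le_cmod[of "f u"] by simp
      qed
    qed
    have sI: "square_integrable (\<lambda>u. of_real (- Im (f u)))"
      using square_integrable_cmult[OF fourier_coeff_Re_Im(2)[OF f], of "-1"] by simp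
    have cE: "continuous_on {-pi..pi} (\<lambda>u. complex_of_real (\<eta> u))"
      by (intro continuous_intros cont)
    have "cmod (of_real (\<eta> (2*x)) - of_real (\<eta> x)) \<le> D * x powr (- (\<beta> / 2)) * (2*x - x)"
      by (rule mean_value_inequality_fourier[OF cE sI deriv _ _ _ ae]) (use x in auto)
    then have 1: "\<bar>\<eta> (2*x) - \<eta> x\<bar> \<le> D * (x powr (- (\<beta> / 2)) * x powr 1)"
      using x by (simp flip: of_real_diff add: mult_ac)
    have "x powr (- (\<beta> / 2)) * x powr 1 = x powr (1 - \<beta> / 2)"
      unfolding powr_add[symmetric] by simp
    with 1 have 1: "\<bar>\<eta> (2*x) - \<eta> x\<bar> \<le> D * x powr (1 - \<beta> / 2)" by simp
    have a: "\<bar>v (2*x) - A * (2 powr \<beta> * x powr \<beta>)\<bar> \<le> e * (2 powr \<beta> * x powr \<beta>)"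
      using v[of "2*x"] x by (simp add: powr_mult)
    have b: "\<bar>v x - A * x powr \<beta>\<bar> \<le> e * x powr \<beta>" by (rule v) (use x in auto)
    have "v (2*x) - v x = \<eta> x - \<eta> (2*x)" by (simp add: v_def)
    then have "v (2*x) - v x \<le> D * x powr (1 - \<beta> / 2)" using 1 by linarith
    moreover have "A * (2 powr \<beta> * x powr \<beta>) - A * x powr \<beta> - e * (2 powr \<beta> * x powr \<beta>) - e * x powr \<beta> \<le> v (2*x) - v x"
      using a b by linarith
    moreover have "A * (2 powr \<beta> * x powr \<beta>) - A * x powr \<beta> - e * (2 powr \<beta> * x powr \<beta>) - e * x powr \<beta>
        = 2 * \<kappa> * x powr \<beta> - e * (2 powr \<beta> + 1) * x powr \<beta>"
      by (simp add: \<kappa>_def field_simps)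
    moreover have "e * (2 powr \<beta> + 1) * x powr \<beta> \<le> \<kappa> * x powr \<beta>"
      using e(3) by (intro mult_right_mono) auto
    ultimately show ?thesis by linarith
  qed
  have ev: "eventually (\<lambda>x. 0 < x \<and> 2 * x < d \<and> 2 * x \<le> pi) (at_right (0::real))"
    unfolding eventually_at_right_field using d(1) pi_gt_zero
    by (intro exI[of _ "min (d/2) (pi/2)"]) auto
  then obtain x where x: "0 < x" "2 * x < d" "2 * x \<le> pi"
    using eventually_happens[OF ev] by auto
  show "c \<noteq> 0"
  proof
    assume "c = 0"
    then have "\<kappa> * x powr \<beta> \<le> 0" using main[OF x] by (simp add: D_def)
    then show False using \<kappa> x by (simp add: mult_le_0_iff)
  qed
  show "2 / 3 \<le> \<beta>"
  proof (rule ccontr)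
    assume "\<not> 2 / 3 \<le> \<beta>"
    then have pos: "0 < 1 - 3 * \<beta> / 2" by simp
    have "eventually (\<lambda>x. \<kappa> \<le> D * x powr (1 - 3 * \<beta> / 2)) (at_right 0)"
      using ev
    proof eventually_elim
      case (elim x)
      have "x powr (1 - \<beta> / 2) = x powr (1 - 3 * \<beta> / 2) * x powr \<beta>"
        unfolding powr_add[symmetric] by simp
      then have "\<kappa> * x powr \<beta> \<le> (D * x powr (1 - 3 * \<beta> / 2)) * x powr \<beta>"
        using main[of x] elim by (simp only: mult.assoc)
      then show ?case by (rule mult_right_le_imp_le) (use elim in simp)
    qed
    moreover have "((\<lambda>x. D * x powr (1 - 3 * \<beta> / 2)) \<longlongrightarrow> D * 0) (at_right 0)"
      by (intro tendsto_mult tendsto_const tendsto_zero_powrI[of _ _ _ "1 - 3 * \<beta> / 2"] pos)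
        (auto simp: eventually_at_right_less intro: eventually_mono[OF eventually_at_right_less])
    ultimately have "\<kappa> \<le> D * 0" by (intro tendsto_lowerbound) auto
    then show False using \<kappa> by simp
  qed
qed

text \<open>
  On the radius towards the crest, \<open>f(r) g(r) = c\<^sup>2/2\<close> keeps \<open>f\<close> and \<open>g\<close> from being small together, while
  the kernel bounds give powers of \<open>1 - r\<close> with exponents near \<open>\<beta> - 1\<close> and \<open>\<beta>/2\<close>, whose sum is positive
  if \<open>\<beta> > 2/3\<close>.
\<close>

lemma exponent_upper_bound:
  fixes c A \<beta> :: real and \<eta> :: "real \<Rightarrow> real"
  assumes A: "A > 0" and \<beta>: "0 < \<beta>" "\<beta> \<le> 1" and c: "c \<noteq> 0"
    and cont: "continuous_on {-pi..pi} \<eta>"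
    and f: "square_integrable f"
      "\<And>n. fourier_coeff f n = (if n < 0 then 0 else if n = 0 then 1 else 2 * of_int n * fourier_coeff (\<lambda>u. complex_of_real (\<eta> u)) n)"
    and G: "square_integrable (\<lambda>u. of_real (c\<^sup>2 / 2 - \<eta> u) * cnj (f u))"
      "\<And>n. n < 0 \<Longrightarrow> fourier_coeff (\<lambda>u. of_real (c\<^sup>2 / 2 - \<eta> u) * cnj (f u)) n = 0"
    and prod: "\<And>n. fourier_coeff (\<lambda>u. f u * (of_real (c\<^sup>2 / 2 - \<eta> u) * cnj (f u))) n = (if n = 0 then of_real (c\<^sup>2 / 2) else 0)"
    and bernoulli: "AE u in circle_measure. (c\<^sup>2 / 2 - \<eta> u) * (cmod (f u))\<^sup>2 = c\<^sup>2 / 2"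
    and asymp: "(\<lambda>u. \<eta> u - (c\<^sup>2 / 2 - A * \<bar>u\<bar> powr \<beta>)) \<in> o[at 0](\<lambda>u. \<bar>u\<bar> powr \<beta>)"
  shows "\<beta> \<le> 2 / 3"
proof (rule ccontr)
  assume "\<not> \<beta> \<le> 2 / 3"
  then have \<beta>_gt: "\<beta> > 2 / 3" by simp
  define g where "g u = of_real (c\<^sup>2 / 2 - \<eta> u) * cnj (f u)" for u
  define v where "v u = c\<^sup>2 / 2 - \<eta> u" for u
  define V where "V u = complex_of_real (v u)" for u
  have cV: "continuous_on {-pi..pi} V"
    unfolding V_def v_def by (intro continuous_intros cont)
  have mV: "V \<in> borel_measurable circle_measure" by (rule continuous_imp_measurable_circle[OF cV])
  obtain B where B: "B \<ge> 0" "\<And>u. u \<in> {-pi..pi} \<Longrightarrow> cmod (V u) \<le> B"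
    using continuous_bounded_circle[OF cV] by blast
  have sV: "square_integrable V" by (rule square_integrable_bounded[OF mV B(2)])
  note iV = square_integrable_integrable[OF sV]
  \<comment> \<open>a global version of the local upper bound\<close>
  obtain C where C: "C > 0" "\<And>u. u \<noteq> 0 \<Longrightarrow> u \<in> {-pi..pi} \<Longrightarrow> \<bar>v u\<bar> \<le> C * \<bar>u\<bar> powr \<beta>"
  proof -
    have "eventually (\<lambda>u. \<bar>\<eta> u - (c\<^sup>2 / 2 - A * \<bar>u\<bar> powr \<beta>)\<bar> \<le> A * \<bar>u\<bar> powr \<beta>) (at 0)"
      using landau_o.smallD[OF asymp A] by simp
    then obtain d where d: "d > 0" "\<And>u. u \<noteq> 0 \<Longrightarrow> \<bar>u\<bar> < d \<Longrightarrow> \<bar>\<eta> u - (c\<^sup>2 / 2 - A * \<bar>u\<bar> powr \<beta>)\<bar> \<le> A * \<bar>u\<bar> powr \<beta>"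
      unfolding eventually_at by (auto simp: dist_real_def)
    define C where "C = 2 * A + B / d powr \<beta>"
    show thesis
    proof (rule that)
      show "C > 0" using A B(1) d(1) by (auto simp: C_def intro!: add_pos_nonneg)
      fix u :: real assume u: "u \<noteq> 0" "u \<in> {-pi..pi}"
      show "\<bar>v u\<bar> \<le> C * \<bar>u\<bar> powr \<beta>"
      proof (cases "\<bar>u\<bar> < d")
        case True
        have "\<bar>v u\<bar> \<le> 2 * A * \<bar>u\<bar> powr \<beta>" using d(2)[OF u(1) True] by (simp add: v_def abs_le_iff)
        also have "\<dots> \<le> C * \<bar>u\<bar> powr \<beta>"
          using B(1) by (intro mult_right_mono) (auto simp: C_def)
        finally show ?thesis .
      next
        case False
        then have "d powr \<beta> \<le> \<bar>u\<bar> powr \<beta>" using d(1) \<beta> by (intro powr_mono2) auto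
        then have "B / d powr \<beta> * d powr \<beta> \<le> B / d powr \<beta> * \<bar>u\<bar> powr \<beta>"
          using B(1) by (intro mult_left_mono) auto
        then have "B \<le> B / d powr \<beta> * \<bar>u\<bar> powr \<beta>" using d(1) by simp
        moreover have "\<bar>v u\<bar> \<le> B" using B(2)[OF u(2)] by (simp add: V_def)
        moreover have "B / d powr \<beta> * \<bar>u\<bar> powr \<beta> \<le> C * \<bar>u\<bar> powr \<beta>"
          using A by (intro mult_right_mono) (auto simp: C_def)
        ultimately show ?thesis by linarith
      qed
    qed
  qed
  have aeV: "AE u in circle_measure. cmod (V u) \<le> C * \<bar>u\<bar> powr \<beta>"
    using AE_circle_neq[of 0] by eventually_elim (use C(2) in \<open>auto simp: V_def\<close>)
  define C' where "C' = sqrt (C * (c\<^sup>2 / 2))"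
  have aeG: "AE u in circle_measure. cmod (g u) \<le> C' * \<bar>u\<bar> powr (\<beta> / 2)"
    using AE_circle_neq[of 0] bernoulli
  proof eventually_elim
    case (elim u)
    have "(cmod (g u))\<^sup>2 = \<bar>v u\<bar>\<^sup>2 * (cmod (f u))\<^sup>2"
      by (simp add: g_def v_def norm_mult power_mult_distrib del: of_real_diff of_real_divide)
    also have "\<dots> = \<bar>v u\<bar> * \<bar>v u * (cmod (f u))\<^sup>2\<bar>"
      by (simp add: power2_eq_square abs_mult)
    also have "v u * (cmod (f u))\<^sup>2 = c\<^sup>2 / 2" using elim by (simp only: v_def)
    also have "\<bar>v u\<bar> * \<bar>c\<^sup>2 / 2\<bar> = \<bar>v u\<bar> * (c\<^sup>2 / 2)" by simp
    also have "\<dots> \<le> (C * \<bar>u\<bar> powr \<beta>) * (c\<^sup>2 / 2)"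
      using C(2)[of u] elim by (intro mult_right_mono) auto
    also have "\<dots> = (C' * \<bar>u\<bar> powr (\<beta> / 2))\<^sup>2"
    proof -
      have "(\<bar>u\<bar> powr (\<beta> / 2))\<^sup>2 = \<bar>u\<bar> powr \<beta>"
        using elim by (simp add: power2_eq_square powr_add[symmetric])
      moreover have "C'\<^sup>2 = C * (c\<^sup>2 / 2)" using C(1) by (simp add: C'_def)
      ultimately show ?thesis by (simp add: power_mult_distrib)
    qed
    finally show ?case by (rule power2_le_imp_le) (use C in \<open>simp add: C'_def\<close>)
  qed
  have C'0: "0 \<le> C'" using C(1) by (simp add: C'_def)
  \<comment> \<open>losing \<open>e\<close> in each of the two kernel bounds uses up half of the margin \<open>3 \<beta> / 2 - 1 = 4 e\<close>\<close>
  define e where "e = (3 * \<beta> / 2 - 1) / 4"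
  have e: "0 < e" "e \<le> \<beta> / 2" "e \<le> \<beta>" using \<beta> \<beta>_gt by (auto simp: e_def)
  define M where "M = (LINT u|circle_measure. \<bar>u\<bar> powr (e - 1))"
  have M0: "0 \<le> M" unfolding M_def by (rule integral_nonneg_AE) simp
  have sg: "square_integrable g" using G(1) by (simp add: g_def[abs_def])
  have gneg: "fourier_coeff g n = 0" if "n < 0" for n using G(2)[OF that] by (simp add: g_def[abs_def])
  have fneg: "fourier_coeff f n = 0" if "n < 0" for n using that by (simp add: f(2))
  have fV: "fourier_coeff f (int (Suc n)) = - 2 * of_nat (Suc n) * fourier_coeff V (int (Suc n))" for n
  proof -
    have "V = (\<lambda>u. of_real (c\<^sup>2 / 2) - of_real (\<eta> u))" by (simp add: V_def v_def fun_eq_iff)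
    moreover have "square_integrable (\<lambda>u. complex_of_real (\<eta> u))"
    proof -
      have "(\<lambda>u. complex_of_real (\<eta> u)) = (\<lambda>u. of_real (c\<^sup>2 / 2) - V u)" by (simp add: V_def v_def fun_eq_iff)
      then show ?thesis using square_integrable_diff[OF square_integrable_const sV, of "of_real (c\<^sup>2 / 2)"] by simp
    qed
    ultimately have "fourier_coeff V (int (Suc n)) = - fourier_coeff (\<lambda>u. complex_of_real (\<eta> u)) (int (Suc n))"
      by (simp add: fourier_coeff_diff square_integrable_integrable square_integrable_const fourier_coeff_const del: of_nat_Suc)
    then show ?thesis by (simp add: f(2) del: of_nat_Suc)
  qed
  define K where "K = 16 * C' * M"
  define L where "L = 16 * C * M"
  have key: "c\<^sup>2 / 2 \<le> K * (1 - r) powr (\<beta> / 2 - e) + K * L * (1 - r) powr (2 * e)"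
    if r: "1 / 2 \<le> r" "r < 1" for r
  proof -
    have sum_f: "summable (\<lambda>n. norm (of_real r ^ n * fourier_coeff h (int n)))" if "square_integrable h" for h
    proof (rule summable_comparison_test')
      show "summable (\<lambda>n. r ^ n * ((LINT u|circle_measure. cmod (h u)) / (2 * pi)))"
        using r by (intro summable_mult2 summable_geometric) auto
      show "norm (norm (of_real r ^ n * fourier_coeff h (int n))) \<le> r ^ n * ((LINT u|circle_measure. cmod (h u)) / (2 * pi))" for n
        using r fourier_coeff_bound[OF square_integrable_integrable[OF that], of "int n"]
        by (simp add: norm_mult norm_power mult_left_mono del: times_divide_eq_right)
    qed
    define fr where "fr = (\<Sum>n. of_real r ^ n * fourier_coeff f (int n))"
    define gr where "gr = (\<Sum>n. of_real r ^ n * fourier_coeff g (int n))"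
    \<comment> \<open>the extensions of \<open>f\<close> and \<open>g\<close> to the disc are reciprocal up to a constant\<close>
    have "(\<lambda>k. \<Sum>i\<le>k. (of_real r ^ i * fourier_coeff f (int i)) * (of_real r ^ (k - i) * fourier_coeff g (int (k - i)))) sums (fr * gr)"
      unfolding fr_def gr_def by (rule Cauchy_product_sums[OF sum_f[OF f(1)] sum_f[OF sg]])
    moreover have "(\<Sum>i\<le>k. (of_real r ^ i * fourier_coeff f (int i)) * (of_real r ^ (k - i) * fourier_coeff g (int (k - i))))
        = (if k = 0 then of_real (c\<^sup>2 / 2) else 0)" for k
    proof -
      have "(\<Sum>i\<le>k. (of_real r ^ i * fourier_coeff f (int i)) * (of_real r ^ (k - i) * fourier_coeff g (int (k - i))))
          = (\<Sum>i\<le>k. of_real r ^ k * (fourier_coeff f (int i) * fourier_coeff g (int (k - i))))"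
      proof (intro sum.cong refl)
        fix i assume "i \<in> {..k}"
        then have "(of_real r ^ k :: complex) = of_real r ^ i * of_real r ^ (k - i)"
          by (simp add: power_add[symmetric])
        then show "(of_real r ^ i * fourier_coeff f (int i)) * (of_real r ^ (k - i) * fourier_coeff g (int (k - i)))
            = of_real r ^ k * (fourier_coeff f (int i) * fourier_coeff g (int (k - i)))"
          by (simp only: mult_ac)
      qed
      also have "\<dots> = of_real r ^ k * fourier_coeff (\<lambda>u. f u * g u) (int k)"
        using one_sided_fourier_coeff_mult(2)[OF f(1) fneg sg gneg, of k]
        by (simp only: sum_distrib_left[symmetric])
      also have "\<dots> = (if k = 0 then of_real (c\<^sup>2 / 2) else 0)"
        using prod[of "int k"] by (simp add: g_def[abs_def])
      finally show ?thesis .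
    qed
    ultimately have "(\<lambda>k::nat. if k = 0 then complex_of_real (c\<^sup>2 / 2) else 0) sums (fr * gr)" by simp
    moreover have "(\<lambda>k::nat. if k = 0 then complex_of_real (c\<^sup>2 / 2) else 0) sums of_real (c\<^sup>2 / 2)"
      using sums_single[of 0 "\<lambda>_. complex_of_real (c\<^sup>2 / 2)"] by simp
    ultimately have "fr * gr = of_real (c\<^sup>2 / 2)" by (rule sums_unique2)
    then have "cmod fr * cmod gr = cmod (of_real (c\<^sup>2 / 2))" by (simp only: norm_mult[symmetric])
    then have fg: "c\<^sup>2 / 2 = cmod fr * cmod gr" by (simp only: norm_of_real) simp
    have gr: "cmod gr \<le> K * (1 - r) powr (\<beta> / 2 - e)"
      unfolding gr_def K_def M_def
      by (rule poisson_bound[OF square_integrable_integrable[OF sg] aeG gneg r e(1,2) _ C'0]) (use \<beta> in auto)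
    have fr: "cmod fr \<le> 1 + L * (1 - r) powr (\<beta> - 1 - e)"
    proof -
      define S where "S = (\<Sum>n. of_nat (Suc n) * of_real r ^ Suc n * fourier_coeff V (int (Suc n)))"
      have "fr = (\<Sum>n. of_real r ^ Suc n * fourier_coeff f (int (Suc n))) + 1"
        using suminf_split_head[OF summable_norm_cancel[OF sum_f[OF f(1)]]] f(2)[of 0]
        by (simp add: fr_def del: of_nat_Suc power_Suc)
      also have "(\<Sum>n. of_real r ^ Suc n * fourier_coeff f (int (Suc n))) = - 2 * S"
      proof -
        have eq: "of_real r ^ Suc n * fourier_coeff f (int (Suc n)) = - 2 * (of_nat (Suc n) * of_real r ^ Suc n * fourier_coeff V (int (Suc n)))" for n
          unfolding fV by (simp only: mult_ac)
        have "summable (\<lambda>n. of_real r ^ Suc n * fourier_coeff f (int (Suc n)))"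
          using summable_norm_cancel[OF sum_f[OF f(1)]] by (subst summable_Suc_iff)
        then have "summable (\<lambda>n. of_nat (Suc n) * of_real r ^ Suc n * fourier_coeff V (int (Suc n)))"
          unfolding eq by (subst (asm) summable_cmult_iff) simp
        then show ?thesis unfolding eq S_def by (rule suminf_mult)
      qed
      finally have "cmod fr \<le> 2 * cmod S + 1"
        using norm_triangle_ineq[of "- 2 * S" 1] by (simp add: norm_mult)
      moreover have "cmod S \<le> 8 * C * M * (1 - r) powr (\<beta> - 1 - e)"
        unfolding S_def M_def
        by (rule derivative_kernel_bound[OF iV aeV r e(1,3) \<beta>(2)]) (use C in simp)
      ultimately show ?thesis by (simp add: L_def)
    qed
    have "c\<^sup>2 / 2 \<le> (1 + L * (1 - r) powr (\<beta> - 1 - e)) * (K * (1 - r) powr (\<beta> / 2 - e))"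
      unfolding fg using fr gr by (intro mult_mono) (auto intro: order_trans[OF norm_ge_zero])
    also have "\<dots> = K * (1 - r) powr (\<beta> / 2 - e) + K * L * ((1 - r) powr (\<beta> - 1 - e) * (1 - r) powr (\<beta> / 2 - e))"
      by (simp add: algebra_simps)
    also have "(1 - r) powr (\<beta> - 1 - e) * (1 - r) powr (\<beta> / 2 - e) = (1 - r) powr (2 * e)"
      unfolding powr_add[symmetric] by (rule arg_cong[where f="\<lambda>x. (1 - r) powr x"]) (simp add: e_def field_simps)
    finally show ?thesis .
  qed
  have "eventually (\<lambda>t. c\<^sup>2 / 2 \<le> K * t powr (\<beta> / 2 - e) + K * L * t powr (2 * e)) (at_right 0)"
    unfolding eventually_at_right_field
  proof (intro exI[of _ "1 / 2"] conjI allI impI)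
    fix t :: real assume "0 < t" "t < 1 / 2"
    then show "c\<^sup>2 / 2 \<le> K * t powr (\<beta> / 2 - e) + K * L * t powr (2 * e)"
      using key[of "1 - t"] by simp
  qed simp
  moreover have lim: "((\<lambda>t. t powr a) \<longlongrightarrow> 0) (at_right 0)" if "0 < a" for a :: real
    by (rule tendsto_zero_powrI[OF _ tendsto_const _ that])
      (auto intro: eventually_mono[OF eventually_at_right_less])
  have "\<beta> / 2 - e > 0" using \<beta> \<beta>_gt by (simp add: e_def field_simps)
  then have "((\<lambda>t. K * t powr (\<beta> / 2 - e) + K * L * t powr (2 * e)) \<longlongrightarrow> K * 0 + K * L * 0) (at_right 0)"
    using e(1) by (intro tendsto_intros lim) auto
  ultimately have "c\<^sup>2 / 2 \<le> K * 0 + K * L * 0" by (intro tendsto_lowerbound) auto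
  then show False using c by simp
qed

theorem theorem1:
  fixes c A \<beta> :: real and \<eta> :: "real \<Rightarrow> real"
  assumes "A > 0"
    and "0 < \<beta>" and "\<beta> \<le> 1"
    and "(\<lambda>u. complex_of_real (\<eta> u)) \<in> Dom_K_inf"
    and "continuous_on UNIV \<eta>"
    and "AE u in circle_measure.
           (of_real (c\<^sup>2) * K_inf (\<lambda>s. of_real (\<eta> s)) u - of_real (\<eta> u))
           - of_real (\<eta> u) * K_inf (\<lambda>s. of_real (\<eta> s)) u
           - 1 / 2 * K_inf (\<lambda>s. of_real ((\<eta> s)\<^sup>2)) u = 0"
    and "(\<lambda>u. \<eta> u - (c\<^sup>2 / 2 - A * \<bar>u\<bar> powr \<beta>)) \<in> o[at 0](\<lambda>u. \<bar>u\<bar> powr \<beta>)"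
  shows "\<beta> = 2 / 3"
proof -
  have cont: "continuous_on {-pi..pi} \<eta>"
    by (rule continuous_on_subset[OF assms(5)]) simp
  obtain f where f: "square_integrable f"
    "\<And>n. fourier_coeff f n = (if n < 0 then 0 else if n = 0 then 1 else 2 * of_int n * fourier_coeff (\<lambda>u. complex_of_real (\<eta> u)) n)"
    using obtain_analytic_derivative[OF assms(4)] by blast
  note B = Babenko_imp_Bernoulli[OF assms(4) cont assms(6) f]
  note lower = exponent_lower_bound[OF assms(1,2) cont f(1) analytic_derivative_parts(1)[OF f] B(4) assms(7)]
  have "\<beta> \<le> 2 / 3"
    by (rule exponent_upper_bound[OF assms(1-3) lower(1) cont f B(1,2,3,4) assms(7)])
  with lower(2) show ?thesis by (rule antisym[rotated])
qed

end
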